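(* As $n\to\infty$, $$g(n)=\frac{n^2}{4}-o(n^2),$$ where $g(n)$ is the largest number $m$ such that every co-triangle-free graph on $n$ vertices contains a triangle packing of size $m$.
   Context: All graphs are finite and simple. A graph is co-triangle-free if its complement contains no triangle (equivalently, its independence number is at most $2$). A triangle packing of a graph $G$ is a collection of pairwise edge-disjoint triangles in $G$; its size is the total number of edges it contains, i.e. three times the number of triangles in it. Let $\nu(G)$ be the size of a largest triangle packing in $G$; then $g(n)=\min\{\nu(G): |V(G)|=n,\ G \text{ co-triangle-free}\}$. The notation $o(n^2)$ denotes a function $h(n)$ with $h(n)/n^2\to 0$ as $n\to\infty$ (of either sign). *)

theory Defs
  imports "HOL-Library.Landau_Symbols" "HOL-Library.Disjoint_Sets" "HOL-Library.Ramsey"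
begin

text \<open>A graph is a pair of a finite vertex set and a set of edges, where an edge is a two-element
  set of vertices; \<^term>\<open>nsets V 2\<close> is the set of all two-element subsets of \<^term>\<open>V\<close>.\<close>

definition simple_graph :: "'a set \<Rightarrow> 'a set set \<Rightarrow> bool" where
  "simple_graph V E \<longleftrightarrow> finite V \<and> E \<subseteq> nsets V 2"

definition complement_edges :: "'a set \<Rightarrow> 'a set set \<Rightarrow> 'a set set" where
  "complement_edges V E = nsets V 2 - E"

text \<open>A triangle is represented by the set of its three edges, so that edge-disjointness of
  triangles is literally disjointness of sets.\<close>

definition triangles :: "'a set set \<Rightarrow> 'a set set set" where
  "triangles E = {{{x, y}, {y, z}, {x, z}} | x y z.
     x \<noteq> y \<and> y \<noteq> z \<and> x \<noteq> z \<and> {x, y} \<in> E \<and> {y, z} \<in> E \<and> {x, z} \<in> E}"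

definition co_triangle_free :: "'a set \<Rightarrow> 'a set set \<Rightarrow> bool" where
  "co_triangle_free V E \<longleftrightarrow> triangles (complement_edges V E) = {}"

definition triangle_packing :: "'a set set \<Rightarrow> 'a set set set \<Rightarrow> bool" where
  "triangle_packing E P \<longleftrightarrow> P \<subseteq> triangles E \<and> disjoint P"

text \<open>The size of a packing counts edges, not triangles; see \<open>packing_size_eq\<close> below.\<close>

definition packing_size :: "'a set set set \<Rightarrow> nat" where
  "packing_size P = card (\<Union>P)"

definition nu :: "'a set set \<Rightarrow> nat" where
  "nu E = Max {packing_size P | P. triangle_packing E P}"

text \<open>Vertices are taken to be natural numbers. This is no restriction, since every finite graph is
  isomorphic to one of these; see \<open>g_works_for_every_type\<close>.\<close>

definition g :: "nat \<Rightarrow> nat" where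
  "g n = (GREATEST m. \<forall>(V :: nat set) E.
     simple_graph V E \<and> card V = n \<and> co_triangle_free V E \<longrightarrow>
     (\<exists>P. triangle_packing E P \<and> packing_size P = m))"

lemma card_triangle: "T \<in> triangles E \<Longrightarrow> card T = 3"
  unfolding triangles_def by (auto simp: doubleton_eq_iff card_insert_if)

lemma triangle_subset: "T \<in> triangles E \<Longrightarrow> T \<subseteq> E"
  unfolding triangles_def by auto

lemma finite_edges: "simple_graph V E \<Longrightarrow> finite E"
  unfolding simple_graph_def by (meson finite_imp_finite_nsets finite_subset)

lemma packing_size_eq:
  assumes "triangle_packing E P"
  shows "packing_size P = 3 * card P"
proof -
  have c: "card T = 3" if "T \<in> P" for T
    using assms that card_triangle unfolding triangle_packing_def by blast
  have "card (\<Union>P) = sum card P"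
  proof (rule card_Union_disjoint)
    show "disjoint P"
      using assms by (simp add: triangle_packing_def)
    show "finite T" if "T \<in> P" for T
      using c[OF that] by (intro card_ge_0_finite) simp
  qed
  then show ?thesis
    using c by (simp add: packing_size_def)
qed

lemma packing_size_le: "finite E \<Longrightarrow> triangle_packing E P \<Longrightarrow> packing_size P \<le> card E"
  unfolding packing_size_def triangle_packing_def
  by (intro card_mono) (auto dest: triangle_subset)

lemma finite_sizes: "finite E \<Longrightarrow> finite {packing_size P | P. triangle_packing E P}"
  by (rule finite_subset[of _ "{..card E}"]) (auto simp: packing_size_le)

lemma nu_attained:
  assumes "finite E"
  obtains P where "triangle_packing E P" "packing_size P = nu E"
proof -
  have "triangle_packing E {}"
    by (simp add: triangle_packing_def)
  then have "nu E \<in> {packing_size P | P. triangle_packing E P}"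
    unfolding nu_def by (intro Max_in finite_sizes assms) auto
  then show thesis
    using that by auto
qed

lemma ex_packing_iff:
  assumes "finite E"
  shows "(\<exists>P. triangle_packing E P \<and> packing_size P = m) \<longleftrightarrow> 3 dvd m \<and> m \<le> nu E"
proof
  assume "\<exists>P. triangle_packing E P \<and> packing_size P = m"
  then show "3 dvd m \<and> m \<le> nu E"
    unfolding nu_def using finite_sizes[OF assms] by (auto simp: packing_size_eq intro!: Max_ge)
next
  assume m: "3 dvd m \<and> m \<le> nu E"
  obtain P where P: "triangle_packing E P" "packing_size P = nu E"
    using nu_attained[OF assms] .
  from m obtain k where k: "m = 3 * k" by blast
  then have "k \<le> card P"
    using P m packing_size_eq[OF P(1)] by linarith
  then obtain Q where Q: "Q \<subseteq> P" "card Q = k"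
    by (meson obtain_subset_with_card_n)
  then have "triangle_packing E Q"
    using P(1) unfolding triangle_packing_def disjoint_def by blast
  then show "\<exists>P. triangle_packing E P \<and> packing_size P = m"
    using Q k packing_size_eq by blast
qed

lemma nu_le_card_edges: "finite E \<Longrightarrow> nu E \<le> card E"
  by (metis nu_attained packing_size_le)

text \<open>The two descriptions of \<open>g\<close>, as the largest guaranteed packing size and as the minimum
  of \<open>nu\<close>, agree, and the \<open>GREATEST\<close> in its definition exists.\<close>

lemma shows g_eq_Min:
    "g n = Min {nu E | (V :: nat set) E. simple_graph V E \<and> card V = n \<and> co_triangle_free V E}"
  and g_works: "\<And>(V :: nat set) E. simple_graph V E \<Longrightarrow> card V = n \<Longrightarrow> co_triangle_free V E \<Longrightarrow>
    \<exists>P. triangle_packing E P \<and> packing_size P = g n"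
proof -
  define S where
    "S = {nu E | (V :: nat set) E. simple_graph V E \<and> card V = n \<and> co_triangle_free V E}"
  define good where "good = (\<lambda>m. \<forall>(V :: nat set) E.
     simple_graph V E \<and> card V = n \<and> co_triangle_free V E \<longrightarrow>
     (\<exists>P. triangle_packing E P \<and> packing_size P = m))"
  have "nu E \<le> n choose 2" if VE: "simple_graph V E" "card V = n" for V :: "nat set" and E
  proof -
    have "card E \<le> card (nsets V 2)"
      using VE(1) unfolding simple_graph_def by (intro card_mono finite_imp_finite_nsets) auto
    also have "\<dots> = n choose 2"
      using VE unfolding simple_graph_def by (metis card_nsets)
    finally show ?thesis
      using nu_le_card_edges[OF finite_edges[OF VE(1)]] by linarith
  qed
  then have "S \<subseteq> {..n choose 2}"
    unfolding S_def by blast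
  then have fin: "finite S"
    by (rule finite_subset) simp
  have "simple_graph {..<n} (nsets {..<n} 2)" "co_triangle_free {..<n} (nsets {..<n} 2)"
    by (simp_all add: simple_graph_def co_triangle_free_def complement_edges_def triangles_def)
  then have ne: "S \<noteq> {}"
    unfolding S_def using card_lessThan by blast
  have dvd: "3 dvd x" if x: "x \<in> S" for x
  proof -
    obtain V :: "nat set" and E where VE: "simple_graph V E" "x = nu E"
      using x unfolding S_def by blast
    then show ?thesis
      by (metis ex_packing_iff finite_edges nu_attained)
  qed
  have good_iff: "good m \<longleftrightarrow> 3 dvd m \<and> m \<le> Min S" for m
  proof -
    have "good m \<longleftrightarrow> (\<forall>x\<in>S. 3 dvd m \<and> m \<le> x)"
      unfolding good_def S_def using ex_packing_iff[OF finite_edges] by blast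
    then show ?thesis
      using fin ne by auto
  qed
  have "good (Min S)"
    using good_iff dvd Min_in[OF fin ne] by blast
  moreover have "g n = (GREATEST m. good m)"
    unfolding g_def good_def ..
  ultimately have eq: "g n = Min S"
    using good_iff by (auto intro!: Greatest_equality)
  then show "g n = Min {nu E | (V :: nat set) E.
      simple_graph V E \<and> card V = n \<and> co_triangle_free V E}"
    unfolding S_def .
  show "\<exists>P. triangle_packing E P \<and> packing_size P = g n"
    if "simple_graph V E" "card V = n" "co_triangle_free V E" for V :: "nat set" and E
    using \<open>good (Min S)\<close> eq that unfolding good_def by metis
qed

lemma image_triangle_packing:
  assumes E: "E \<subseteq> nsets V 2" and P: "triangle_packing E P" and h: "inj_on h V"
  shows "triangle_packing ((`) h ` E) ((`) ((`) h) ` P)"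
    and "packing_size ((`) ((`) h) ` P) = packing_size P"
proof -
  have "E \<subseteq> Pow V"
    using E by (auto simp: nsets_def)
  then have h2: "inj_on ((`) h) E"
    using h by (meson inj_on_image_Pow inj_on_subset)
  have PE: "\<Union>P \<subseteq> E"
    using P triangle_subset unfolding triangle_packing_def by blast
  have "(`) ((`) h) ` P \<subseteq> triangles ((`) h ` E)"
  proof clarify
    fix T assume "T \<in> P"
    then obtain x y z where T: "T = {{x, y}, {y, z}, {x, z}}"
      "x \<noteq> y" "y \<noteq> z" "x \<noteq> z" "{x, y} \<in> E" "{y, z} \<in> E" "{x, z} \<in> E"
      using P unfolding triangle_packing_def triangles_def by blast
    then have V: "x \<in> V" "y \<in> V" "z \<in> V"
      using \<open>E \<subseteq> Pow V\<close> by auto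
    have "{h x, h y} \<in> (`) h ` E" "{h y, h z} \<in> (`) h ` E" "{h x, h z} \<in> (`) h ` E"
      using T(5-7)[THEN imageI, of "(`) h"] by simp_all
    moreover have "h x \<noteq> h y" "h y \<noteq> h z" "h x \<noteq> h z"
      using V T(2-4) h by (auto dest: inj_onD)
    ultimately show "(`) h ` T \<in> triangles ((`) h ` E)"
      unfolding triangles_def T(1) by auto
  qed
  moreover have "disjoint ((`) ((`) h) ` P)"
    unfolding disjoint_def
  proof clarify
    fix S T assume ST: "S \<in> P" "T \<in> P" "(`) h ` S \<noteq> (`) h ` T"
    then have "S \<inter> T = {}"
      using P unfolding triangle_packing_def disjoint_def by blast
    then show "(`) h ` S \<inter> (`) h ` T = {}"
      using inj_on_image_Int[OF h2, of S T] ST(1,2) PE by (simp add: Sup_le_iff)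
  qed
  ultimately show "triangle_packing ((`) h ` E) ((`) ((`) h) ` P)"
    unfolding triangle_packing_def by blast
  have "\<Union>((`) ((`) h) ` P) = (`) h ` \<Union>P"
    by blast
  then show "packing_size ((`) ((`) h) ` P) = packing_size P"
    unfolding packing_size_def using card_image[OF inj_on_subset[OF h2 PE]] by simp
qed

lemma g_works_for_every_type:
  fixes V :: "'a set"
  assumes G: "simple_graph V E" and n: "card V = n" and tf: "co_triangle_free V E"
  shows "\<exists>P. triangle_packing E P \<and> packing_size P = g n"
proof -
  have EV: "E \<subseteq> nsets V 2" and "finite V"
    using G by (auto simp: simple_graph_def)
  then obtain f where f: "bij_betw f V {0..<n}"
    using n ex_bij_betw_finite_nat by blast
  then have inj: "inj_on f V" and im: "f ` V = {0..<n}"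
    by (auto simp: bij_betw_def)
  let ?W = "{0..<n}" and ?E = "(`) f ` E" and ?h = "inv_into V f"
  have EW: "?E \<subseteq> nsets ?W 2"
  proof clarify
    fix e assume "e \<in> E"
    then have "e \<subseteq> V" "card e = 2" "finite e"
      using EV by (auto simp: nsets_def)
    then show "f ` e \<in> nsets ?W 2"
      using im inj card_image[OF inj_on_subset[OF inj]] by (auto simp: nsets_def)
  qed
  have "co_triangle_free ?W ?E"
    unfolding co_triangle_free_def
  proof (rule ccontr)
    assume "triangles (complement_edges ?W ?E) \<noteq> {}"
    then obtain a b c where abc: "a \<noteq> b" "b \<noteq> c" "a \<noteq> c"
        "{a, b} \<in> complement_edges ?W ?E" "{b, c} \<in> complement_edges ?W ?E"
        "{a, c} \<in> complement_edges ?W ?E"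
      unfolding triangles_def by blast
    then have "a \<in> f ` V" "b \<in> f ` V" "c \<in> f ` V"
      unfolding im complement_edges_def by auto
    then obtain x y z where xyz: "x \<in> V" "y \<in> V" "z \<in> V" "a = f x" "b = f y" "c = f z"
      by blast
    have *: "{u, v} \<in> complement_edges V E"
      if "u \<in> V" "v \<in> V" "u \<noteq> v" "{f u, f v} \<in> complement_edges ?W ?E" for u v
      using that unfolding complement_edges_def by (auto simp: image_iff dest!: bspec[of E])
    have "{{x, y}, {y, z}, {x, z}} \<in> triangles (complement_edges V E)"
      using abc xyz * unfolding triangles_def by blast
    then show False
      using tf unfolding co_triangle_free_def by blast
  qed
  moreover have "simple_graph ?W ?E"
    using EW by (simp add: simple_graph_def)
  ultimately obtain P where P: "triangle_packing ?E P" "packing_size P = g n"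
    using g_works[of ?W ?E n] by auto
  have "?h ` f ` e = e" if "e \<in> E" for e
    using that EV by (intro inv_into_image_cancel[OF inj]) (auto simp: nsets_def)
  then have "(`) ?h ` ?E = E"
    by (simp add: image_image)
  moreover have "inj_on ?h ?W"
    using f by (metis bij_betw_def bij_betw_inv_into)
  ultimately show ?thesis
    using image_triangle_packing[OF EW P(1), of ?h] P(2) by metis
qed

end

theory Submission
  imports Defs "HOL-Analysis.Analysis"
begin

text \<open>A disjoint union of two cliques of size about \<open>n/2\<close> has at most \<open>n\<^sup>2/4\<close> edges, so \<open>g n \<le> n\<^sup>2/4\<close> (\<open>g_le\<close>).
  For the lower bound let \<open>G\<close> be the complement of a triangle-free graph \<open>H\<close> on \<open>n\<close> vertices. The proof
  bounds the fractional version of the problem by duality, and rounds a fractional packing to a packing.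

  By linear programming duality (\<open>fractional_matching_of_cover_bound\<close>) a lower bound for fractional packings follows
  from one for fractional covers \<open>w\<close> of the triangles of \<open>G\<close>: the total weight of \<open>w\<close> must be at least
  \<open>n\<^sup>2/12 - O(n)\<close>. Choose weights \<open>m\<close> on the vertices that minimise the quadratic form of \<open>w\<close>. For these all
  vertices have the same weighted \<open>w\<close>-degree \<open>Q\<close>, and it suffices to show \<open>Q \<ge> 1/6\<close>
  (\<open>ex_equalizing_weights\<close>, \<open>fractional_cover_bound\<close>). If some \<open>H\<close>-neighbourhood has measure at least \<open>1/2\<close>, then
  averaging over this clique of \<open>G\<close> suffices. Otherwise the inequalities \<open>w x y + w y z + w x z \<ge> 1\<close> are added up with
  coefficients that decrease with the number of common \<open>H\<close>-neighbours of \<open>x, y, z\<close>, chosen such that the result can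
  be evaluated with the degree condition alone (\<open>equalized_cover_value\<close>).

  To round, take for a large constant \<open>k\<close> the average of fractional packings of all induced subgraphs on \<open>k\<close>
  vertices. It is nearly as large, and each triangle has weight \<open>O(1/n)\<close> (\<open>spread_fractional_packing\<close>). As two
  triangles share at most one edge, the nibble method turns it into a set of pairwise edge-disjoint triangles with a
  loss of only \<open>o(n\<^sup>2)\<close> (\<open>matching_of_spread_system\<close>).\<close>

section \<open>Fractional triangle covers with equal degrees\<close>

text \<open>The heart of the argument. Here \<open>H\<close> is a triangle-free graph, \<open>w\<close> a fractional cover of the triangles
  of its complement (a triangle may repeat vertices), and \<open>m\<close> a weighting of the vertices for which
  all vertices have the same \<open>w\<close>-degree \<open>Q\<close>. Let \<open>d x\<close> be the \<open>m\<close>-measure of the \<open>H\<close>-neighbourhood of \<open>x\<close>.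

  If \<open>d u \<ge> 1/2\<close> for some \<open>u\<close>, then the neighbourhood of \<open>u\<close> is a clique of the complement. Averaging the cover
  inequality over it shows that \<open>w\<close> has mean at least \<open>1/3\<close> there, so \<open>Q \<ge> d u / 3\<close>.

  If all \<open>d x < 1/2\<close>, weight the complement's triangle \<open>xyz\<close> by \<open>1 - 2 m(N x \<inter> N y \<inter> N z)\<close>, which is positive.
  This kills most of the surplus that pairs with many common neighbours would collect: the total weight \<open>F x y\<close>
  of the triangles on a pair is at most \<open>s x + s y\<close> for a function \<open>s\<close> of single vertices. Against
  such a bound the cover is known exactly, since
  \<open>\<Sum>m x m y w x y (s x + s y) = 2 Q \<Sum>m x s x\<close>. The resulting inequality
  \<open>3 Q \<Sum>m e (1 + d) \<ge> \<Sum>m e (1 - d + d\<^sup>2)\<close> with \<open>e = 1 - 2 d > 0\<close> gives \<open>Q \<ge> 1/6\<close> because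
  \<open>2 (1 - d + d\<^sup>2) - (1 + d) = (1 - d) (1 - 2 d)\<close>.\<close>

lemma equalized_cover_value:
  fixes w :: "'a \<Rightarrow> 'a \<Rightarrow> real" and m :: "'a \<Rightarrow> real"
  assumes fin: "finite V"
    and mpos: "\<And>x. x \<in> V \<Longrightarrow> 0 < m x" and m1: "(\<Sum>x\<in>V. m x) = 1"
    and Hsym: "\<And>x y. H x y \<Longrightarrow> H y x"
    and Htf: "\<And>x y z. H x y \<Longrightarrow> H y z \<Longrightarrow> \<not> H x z"
    and wsym: "\<And>x y. w x y = w y x" and w0: "\<And>x y. 0 \<le> w x y"
    and wH: "\<And>x y. H x y \<Longrightarrow> w x y = 0"
    and cover: "\<And>x y z. x \<in> V \<Longrightarrow> y \<in> V \<Longrightarrow> z \<in> V \<Longrightarrow>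
      \<not> H x y \<Longrightarrow> \<not> H y z \<Longrightarrow> \<not> H x z \<Longrightarrow> 1 \<le> w x y + w y z + w x z"
    and deg: "\<And>x. x \<in> V \<Longrightarrow> (\<Sum>y\<in>V. m y * w x y) = Q"
  shows "1/6 \<le> Q"
proof -
  define h where "h x y = (of_bool (H x y) :: real)" for x y
  define d where "d x = (\<Sum>y\<in>V. m y * h x y)" for x
  have hsym: "h x y = h y x" for x y
    using Hsym[of x y] Hsym[of y x] unfolding h_def by auto
  have h01: "0 \<le> h x y" "h x y \<le> 1" for x y
    unfolding h_def by auto
  have m0: "0 \<le> m x" if "x \<in> V" for x
    using mpos[OF that] by simp
  show ?thesis
  proof (cases "\<exists>u\<in>V. 1/2 \<le> d u")
    case True
    then obtain u where u: "u \<in> V" "1/2 \<le> d u" by blast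
    define p where "p x = m x * h u x" for x
    have p0: "0 \<le> p x" if "x \<in> V" for x
      unfolding p_def using m0[OF that] h01 by simp
    have psum: "(\<Sum>x\<in>V. p x) = d u"
      unfolding p_def d_def by simp
    define W where "W = (\<Sum>x\<in>V. \<Sum>y\<in>V. p x * p y * w x y)"
    have "d u ^ 3 = (\<Sum>x\<in>V. \<Sum>y\<in>V. \<Sum>z\<in>V. p x * p y * p z)"
      by (simp add: psum[symmetric] power3_eq_cube sum_product sum_distrib_left sum_distrib_right mult_ac)
    also have "\<dots> \<le> (\<Sum>x\<in>V. \<Sum>y\<in>V. \<Sum>z\<in>V. p x * p y * p z * (w x y + w y z + w x z))"
    proof (intro sum_mono)
      fix x y z assume V: "x \<in> V" "y \<in> V" "z \<in> V"
      show "p x * p y * p z \<le> p x * p y * p z * (w x y + w y z + w x z)"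
      proof (cases "H u x \<and> H u y \<and> H u z")
        case True
        then have "\<not> H x y" "\<not> H y z" "\<not> H x z"
          using Htf Hsym by blast+
        from mult_left_mono[OF cover[OF V this], of "p x * p y * p z"] show ?thesis
          using p0 V by simp
      qed (auto simp: p_def h_def)
    qed
    also have "\<dots> = (\<Sum>x\<in>V. \<Sum>y\<in>V. \<Sum>z\<in>V. p x * p y * w x y * p z)
        + (\<Sum>x\<in>V. \<Sum>y\<in>V. \<Sum>z\<in>V. p x * (p y * p z * w y z))
        + (\<Sum>x\<in>V. \<Sum>y\<in>V. \<Sum>z\<in>V. p y * (p x * p z * w x z))"
      by (simp add: sum.distrib[symmetric] algebra_simps)
    also have "(\<Sum>x\<in>V. \<Sum>y\<in>V. \<Sum>z\<in>V. p x * p y * w x y * p z) = W * d u"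
      unfolding W_def psum[symmetric] by (simp add: sum_distrib_left[symmetric] sum_distrib_right)
    also have "(\<Sum>x\<in>V. \<Sum>y\<in>V. \<Sum>z\<in>V. p x * (p y * p z * w y z)) = W * d u"
      unfolding W_def psum[symmetric] by (simp add: sum_distrib_left[symmetric] sum_distrib_right[symmetric])
    also have "(\<Sum>x\<in>V. \<Sum>y\<in>V. \<Sum>z\<in>V. p y * (p x * p z * w x z)) = W * d u"
      by (subst sum.swap)
        (simp add: W_def psum[symmetric] sum_distrib_left[symmetric] sum_distrib_right[symmetric])
    finally have "d u ^ 3 \<le> 3 * W * d u" by simp
    moreover have "W \<le> d u * Q"
    proof -
      have "W = (\<Sum>x\<in>V. p x * (\<Sum>y\<in>V. p y * w x y))"
        unfolding W_def by (simp add: sum_distrib_left mult_ac)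
      also have "\<dots> \<le> (\<Sum>x\<in>V. p x * Q)"
      proof (intro sum_mono mult_left_mono p0)
        fix x assume x: "x \<in> V"
        have "(\<Sum>y\<in>V. p y * w x y) \<le> (\<Sum>y\<in>V. m y * w x y)"
          unfolding p_def using m0 h01 w0 by (intro sum_mono mult_right_mono) (auto simp: mult_left_le)
        then show "(\<Sum>y\<in>V. p y * w x y) \<le> Q" using deg[OF x] by simp
      qed
      finally show ?thesis by (simp add: psum[symmetric] sum_distrib_right)
    qed
    ultimately have "d u * d u \<le> 3 * W \<and> W \<le> d u * Q"
      using u(2) by (simp add: power3_eq_cube)
    then have "d u * d u \<le> d u * (3 * Q)" by simp
    then have "d u \<le> 3 * Q"
      using u(2) mult_le_cancel_left_pos[of "d u"] by simp
    then show ?thesis using u(2) by simp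
  next
    case False
    then have dlt: "d x < 1/2" if "x \<in> V" for x using that by force
    define e where "e x = 1 - 2 * d x" for x
    define a where "a x y = 1 - h x y" for x y
    define \<psi> where "\<psi> x y z = 1 - 2 * (\<Sum>v\<in>V. m v * (h x v * h y v * h z v))" for x y z
    define K where "K x y z = m x * m y * m z * (a x y * a y z * a x z) * \<psi> x y z" for x y z
    define F where "F x y = (\<Sum>z\<in>V. m z * (a y z * a x z) * \<psi> x y z)" for x y
    define c where "c x y = (\<Sum>v\<in>V. m v * e v * (h x v * h y v))" for x y
    define s where "s x = (e x + (\<Sum>v\<in>V. m v * e v * h x v)) / 2" for x
    have epos: "0 < e x" if "x \<in> V" for x
      using dlt[OF that] unfolding e_def by simp
    have d0: "0 \<le> d x" for x
      unfolding d_def using m0 h01 by (intro sum_nonneg) simp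
    have a01: "0 \<le> a x y" for x y
      unfolding a_def using h01 by simp
    have asym: "a x y = a y x" for x y
      unfolding a_def using hsym by metis
    have \<psi>0: "0 \<le> \<psi> x y z" if "x \<in> V" for x y z
    proof -
      have "(\<Sum>v\<in>V. m v * (h x v * h y v * h z v)) \<le> d x"
        unfolding d_def using m0 h01
        by (intro sum_mono mult_left_mono) (auto simp: mult_le_one mult.assoc mult_left_le)
      then show ?thesis using dlt[OF that] unfolding \<psi>_def by simp
    qed
    have K0: "0 \<le> K x y z" if "x \<in> V" "y \<in> V" "z \<in> V" for x y z
      unfolding K_def using m0 a01 \<psi>0 that by simp
    have Ksym: "K x y z = K y z x" "K x y z = K x z y" for x y z
      unfolding K_def \<psi>_def by (simp_all add: asym[of y x] asym[of z x] asym[of z y] mult_ac)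
    have KF: "(\<Sum>z\<in>V. K x y z) = m x * m y * a x y * F x y" for x y
      unfolding K_def F_def by (simp add: sum_distrib_left mult_ac)
    \<comment> \<open>The cover inequalities, summed with the symmetric weights \<open>K\<close>: by symmetry each of the three edges
      of a triangle contributes the same amount.\<close>
    have "(\<Sum>x\<in>V. \<Sum>y\<in>V. \<Sum>z\<in>V. K x y z)
        \<le> (\<Sum>x\<in>V. \<Sum>y\<in>V. \<Sum>z\<in>V. K x y z * (w x y + w y z + w x z))"
    proof (intro sum_mono)
      fix x y z assume V: "x \<in> V" "y \<in> V" "z \<in> V"
      show "K x y z \<le> K x y z * (w x y + w y z + w x z)"
      proof (cases "H x y \<or> H y z \<or> H x z")
        case True then show ?thesis by (auto simp: K_def a_def h_def)
      next
        case False
        then show ?thesis using mult_left_mono[OF cover[OF V], of "K x y z"] K0[OF V] by auto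
      qed
    qed
    also have "\<dots> = (\<Sum>x\<in>V. \<Sum>y\<in>V. \<Sum>z\<in>V. K x y z * w x y)
        + (\<Sum>x\<in>V. \<Sum>y\<in>V. \<Sum>z\<in>V. K y z x * w y z)
        + (\<Sum>x\<in>V. \<Sum>y\<in>V. \<Sum>z\<in>V. K x z y * w x z)"
      by (simp add: sum.distrib[symmetric] distrib_left Ksym[symmetric])
    also have "(\<Sum>x\<in>V. \<Sum>y\<in>V. \<Sum>z\<in>V. K y z x * w y z) = (\<Sum>x\<in>V. \<Sum>y\<in>V. \<Sum>z\<in>V. K x y z * w x y)"
      by (subst sum.swap, rule sum.cong[OF refl], subst sum.swap) simp
    also have "(\<Sum>x\<in>V. \<Sum>y\<in>V. \<Sum>z\<in>V. K x z y * w x z) = (\<Sum>x\<in>V. \<Sum>y\<in>V. \<Sum>z\<in>V. K x y z * w x y)"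
      by (rule sum.cong[OF refl], subst sum.swap) simp
    finally have main: "(\<Sum>x\<in>V. \<Sum>y\<in>V. m x * m y * a x y * F x y)
        \<le> 3 * (\<Sum>x\<in>V. \<Sum>y\<in>V. m x * m y * a x y * F x y * w x y)"
      by (simp add: KF sum_distrib_right[symmetric])
    have Feq: "F x y = (e x + e y) / 2 + c x y" if xy: "\<not> H x y" for x y
    proof -
      \<comment> \<open>A vertex \<open>z\<close> that shares the neighbour \<open>v\<close> with \<open>x\<close> and \<open>y\<close> is adjacent to neither of them, as \<open>H\<close> is
        triangle-free.\<close>
      have absorb: "a y z * a x z * (h x v * h y v * h z v) = h x v * h y v * h v z" for z v
      proof (cases "H x v \<and> H y v \<and> H v z")
        case True
        then have "H z v" "\<not> H y z" "\<not> H x z" using Htf Hsym by blast+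
        then show ?thesis using True by (simp add: a_def h_def)
      next
        case False
        then show ?thesis using Hsym[of z v] by (auto simp: h_def)
      qed
      have "F x y = (\<Sum>z\<in>V. m z * (a y z * a x z))
          - 2 * (\<Sum>z\<in>V. \<Sum>v\<in>V. m z * m v * (a y z * a x z * (h x v * h y v * h z v)))"
        unfolding F_def \<psi>_def
        by (simp add: right_diff_distrib sum_subtractf sum_distrib_left sum_distrib_right mult_ac)
      also have "(\<Sum>z\<in>V. \<Sum>v\<in>V. m z * m v * (a y z * a x z * (h x v * h y v * h z v)))
          = (\<Sum>v\<in>V. m v * (h x v * h y v) * d v)"
        unfolding absorb d_def by (subst sum.swap) (simp add: sum_distrib_left mult_ac)
      also have "(\<Sum>z\<in>V. m z * (a y z * a x z)) = 1 - d x - d y + (\<Sum>v\<in>V. m v * (h x v * h y v))"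
      proof -
        have "m z * (a y z * a x z) = m z - m z * h x z - m z * h y z + m z * (h x z * h y z)" for z
          unfolding a_def by (simp add: algebra_simps)
        then show ?thesis by (simp add: sum.distrib sum_subtractf m1 d_def)
      qed
      finally have "F x y = 1 - d x - d y + ((\<Sum>v\<in>V. m v * (h x v * h y v))
          - 2 * (\<Sum>v\<in>V. m v * (h x v * h y v) * d v))" by simp
      moreover have "c x y = (\<Sum>v\<in>V. m v * (h x v * h y v)) - 2 * (\<Sum>v\<in>V. m v * (h x v * h y v) * d v)"
        unfolding c_def e_def by (simp add: algebra_simps sum_subtractf sum_distrib_left)
      ultimately show ?thesis unfolding e_def by (simp add: field_simps)
    qed
    have "(\<Sum>x\<in>V. \<Sum>y\<in>V. m x * m y * a x y * F x y * w x y)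
        \<le> (\<Sum>x\<in>V. \<Sum>y\<in>V. m x * m y * (s x + s y) * w x y)"
    proof (intro sum_mono)
      fix x y assume V: "x \<in> V" "y \<in> V"
      show "m x * m y * a x y * F x y * w x y \<le> m x * m y * (s x + s y) * w x y"
      proof (cases "H x y")
        case True then show ?thesis using wH by simp
      next
        case False
        \<comment> \<open>Lose the product structure of \<open>c\<close>: an indicator of two events is at most their mean.\<close>
        have "c x y \<le> (\<Sum>v\<in>V. m v * e v * ((h x v + h y v) / 2))"
          unfolding c_def
        proof (intro sum_mono mult_left_mono)
          fix v assume "v \<in> V"
          then show "0 \<le> m v * e v" using m0 epos by (simp add: less_imp_le)
          show "h x v * h y v \<le> (h x v + h y v) / 2" unfolding h_def by auto
        qed
        then have "F x y \<le> s x + s y"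
          unfolding Feq[OF False] s_def
          by (simp add: sum.distrib[symmetric] add_divide_distrib sum_divide_distrib distrib_left)
        then have "m x * m y * F x y * w x y \<le> m x * m y * (s x + s y) * w x y"
          using V m0 w0 by (intro mult_right_mono mult_left_mono) simp_all
        then show ?thesis using False by (simp add: a_def h_def)
      qed
    qed
    also have "\<dots> = (\<Sum>x\<in>V. \<Sum>y\<in>V. m x * s x * (m y * w x y)) + (\<Sum>x\<in>V. \<Sum>y\<in>V. m y * s y * (m x * w y x))"
      by (simp add: sum.distrib[symmetric] algebra_simps wsym)
    also have "(\<Sum>x\<in>V. \<Sum>y\<in>V. m y * s y * (m x * w y x)) = (\<Sum>x\<in>V. \<Sum>y\<in>V. m x * s x * (m y * w x y))"
      by (rule sum.swap)
    also have "(\<Sum>x\<in>V. \<Sum>y\<in>V. m x * s x * (m y * w x y)) = Q * (\<Sum>x\<in>V. m x * s x)"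
      by (simp add: sum_distrib_left[symmetric] deg sum_distrib_right[symmetric] mult.commute)
    also have "(\<Sum>x\<in>V. m x * s x) = (\<Sum>x\<in>V. m x * e x * (1 + d x)) / 2"
    proof -
      have "(\<Sum>x\<in>V. \<Sum>v\<in>V. m x * (m v * e v * h x v)) = (\<Sum>v\<in>V. m v * e v * d v)"
        unfolding d_def by (subst sum.swap) (simp add: sum_distrib_left hsym mult_ac)
      then show ?thesis
        unfolding s_def by (simp add: distrib_left sum.distrib sum_divide_distrib[symmetric] sum_distrib_left)
    qed
    finally have up: "(\<Sum>x\<in>V. \<Sum>y\<in>V. m x * m y * a x y * F x y * w x y)
        \<le> Q * (\<Sum>x\<in>V. m x * e x * (1 + d x))" by simp
    have "(\<Sum>x\<in>V. \<Sum>y\<in>V. m x * m y * a x y * F x y)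
        = (\<Sum>x\<in>V. \<Sum>y\<in>V. m x * m y * a x y * ((e x + e y) / 2)) + (\<Sum>x\<in>V. \<Sum>y\<in>V. m x * m y * a x y * c x y)"
      unfolding sum.distrib[symmetric]
    proof (intro sum.cong refl)
      fix x y
      show "m x * m y * a x y * F x y = m x * m y * a x y * ((e x + e y) / 2) + m x * m y * a x y * c x y"
        by (cases "H x y") (simp_all add: Feq distrib_left a_def h_def)
    qed
    also have "(\<Sum>x\<in>V. \<Sum>y\<in>V. m x * m y * a x y * ((e x + e y) / 2))
        = (\<Sum>x\<in>V. \<Sum>y\<in>V. m x * e x * (m y * a x y)) / 2 + (\<Sum>x\<in>V. \<Sum>y\<in>V. m y * e y * (m x * a y x)) / 2"
      by (simp add: sum.distrib[symmetric] add_divide_distrib[symmetric] sum_divide_distrib algebra_simps asym)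
    also have "(\<Sum>x\<in>V. \<Sum>y\<in>V. m y * e y * (m x * a y x)) = (\<Sum>x\<in>V. \<Sum>y\<in>V. m x * e x * (m y * a x y))"
      by (rule sum.swap)
    also have "(\<Sum>x\<in>V. \<Sum>y\<in>V. m x * e x * (m y * a x y)) = (\<Sum>x\<in>V. m x * e x * (1 - d x))"
      by (simp add: sum_distrib_left[symmetric] a_def right_diff_distrib sum_subtractf m1 d_def)
    also have "(\<Sum>x\<in>V. \<Sum>y\<in>V. m x * m y * a x y * c x y) = (\<Sum>v\<in>V. m v * e v * d v ^ 2)"
    proof -
      have "m x * m y * a x y * c x y = (\<Sum>v\<in>V. m v * e v * (m x * h v x) * (m y * h v y))" for x y
        unfolding c_def sum_distrib_left
      proof (intro sum.cong refl)
        fix v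
        show "m x * m y * a x y * (m v * e v * (h x v * h y v)) = m v * e v * (m x * h v x) * (m y * h v y)"
        proof (cases "H x v \<and> H y v")
          case True
          then have "H v x" "H v y" "\<not> H x y" using Htf Hsym by blast+
          then show ?thesis using True by (simp add: a_def h_def)
        next
          case False
          then show ?thesis using Hsym[of v x] Hsym[of v y] by (auto simp: h_def)
        qed
      qed
      then have "(\<Sum>x\<in>V. \<Sum>y\<in>V. m x * m y * a x y * c x y)
          = (\<Sum>x\<in>V. \<Sum>y\<in>V. \<Sum>v\<in>V. m v * e v * (m x * h v x) * (m y * h v y))" by simp
      also have "\<dots> = (\<Sum>x\<in>V. \<Sum>v\<in>V. \<Sum>y\<in>V. m v * e v * (m x * h v x) * (m y * h v y))"
        by (rule sum.cong[OF refl], rule sum.swap)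
      also have "\<dots> = (\<Sum>v\<in>V. \<Sum>x\<in>V. \<Sum>y\<in>V. m v * e v * (m x * h v x) * (m y * h v y))"
        by (rule sum.swap)
      also have "\<dots> = (\<Sum>v\<in>V. m v * e v * d v ^ 2)"
        unfolding d_def power2_eq_square sum_product
        by (simp add: sum_distrib_left mult_ac)
      finally show ?thesis .
    qed
    finally have low: "(\<Sum>x\<in>V. \<Sum>y\<in>V. m x * m y * a x y * F x y) = (\<Sum>x\<in>V. m x * e x * (1 - d x + d x ^ 2))"
      by (simp add: distrib_left sum.distrib)
    have "(\<Sum>x\<in>V. m x * e x * (1 + d x)) / 2 \<le> (\<Sum>x\<in>V. m x * e x * (1 - d x + d x ^ 2))"
      unfolding sum_divide_distrib
    proof (rule sum_mono)
      fix x assume x: "x \<in> V"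
      have "0 \<le> (1 - d x) * (1 - 2 * d x)" using dlt[OF x] by simp
      then have "(1 + d x) / 2 \<le> 1 - d x + d x ^ 2" by (simp add: field_simps power2_eq_square)
      from mult_left_mono[OF this, of "m x * e x"] show "m x * e x * (1 + d x) / 2 \<le> m x * e x * (1 - d x + d x ^ 2)"
        using m0[OF x] epos[OF x] by simp
    qed
    then have "(\<Sum>x\<in>V. m x * e x * (1 + d x)) / 2 \<le> 3 * Q * (\<Sum>x\<in>V. m x * e x * (1 + d x))"
      using main up low by simp
    moreover have "0 < (\<Sum>x\<in>V. m x * e x * (1 + d x))"
    proof (rule sum_pos[OF fin])
      show "V \<noteq> {}" using m1 by auto
    qed (use mpos epos d0 in \<open>simp add: add_pos_nonneg\<close>)
    ultimately show ?thesis by simp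
  qed
qed

section \<open>Fractional triangle covers of co-triangle-free graphs\<close>

lemma compact_function_box:
  fixes c :: real
  shows "compact {f. (\<forall>i\<in>I. 0 \<le> f i \<and> f i \<le> c) \<and> (\<forall>i. i \<notin> I \<longrightarrow> f i = 0)}"
proof -
  have eq: "{f. (\<forall>i\<in>I. 0 \<le> f i \<and> f i \<le> c) \<and> (\<forall>i. i \<notin> I \<longrightarrow> f i = 0)}
      = PiE UNIV (\<lambda>i. if i \<in> I then {0..c} else {0})"
    by (fastforce simp: PiE_iff split: if_splits)
  show ?thesis
    unfolding eq compactin_euclidean_iff[symmetric] euclidean_product_topology[symmetric]
    by (simp add: compactin_PiE)
qed

lemma continuous_on_coordinate: "continuous_on S (\<lambda>f. f i :: real)"
  by (rule continuous_on_subset[OF continuous_on_product_coordinates]) simp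

text \<open>First-order optimality without derivatives: an extremum perturbed by a small \<open>t\<close> gains \<open>t D\<close> at first order and
  loses at most \<open>t\<^sup>2 c\<close>.\<close>

lemma nonpos_if_small_multiples:
  fixes D c r :: real
  assumes r: "0 < r" and le: "\<And>t. 0 < t \<Longrightarrow> t \<le> r \<Longrightarrow> t * D \<le> t * t * c"
  shows "D \<le> 0"
proof (rule ccontr)
  assume D: "\<not> D \<le> 0"
  define t where "t = min r (D / (1 + \<bar>c\<bar>))"
  have t: "0 < t" "t \<le> r" using r D unfolding t_def by simp_all
  have "t * (1 + \<bar>c\<bar>) \<le> D / (1 + \<bar>c\<bar>) * (1 + \<bar>c\<bar>)"
    unfolding t_def by (intro mult_right_mono) auto
  also have "\<dots> = D" using abs_ge_zero[of c] by simp
  also have "D \<le> t * c" using le[OF t] t(1) by (simp add: mult.assoc)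
  also have "t * c \<le> t * \<bar>c\<bar>" using t(1) by (intro mult_left_mono) auto
  finally show False using t(1) by (simp add: distrib_left)
qed

text \<open>As in the argument of Motzkin and Straus, the weights minimise the quadratic form of \<open>w\<close> over the
  simplex. At a minimum no mass can profitably be moved between two vertices, so all vertices of positive weight
  have the same \<open>w\<close>-degree, which is the minimum itself; comparison with the uniform weights bounds it.\<close>

lemma ex_equalizing_weights:
  fixes w :: "'a \<Rightarrow> 'a \<Rightarrow> real"
  assumes fin: "finite V" and ne: "V \<noteq> {}" and wsym: "\<And>x y. w x y = w y x"
  obtains m Q where "\<And>x. x \<in> V \<Longrightarrow> 0 \<le> m x" "(\<Sum>x\<in>V. m x) = 1"
    "\<And>x. x \<in> V \<Longrightarrow> 0 < m x \<Longrightarrow> (\<Sum>y\<in>V. m y * w x y) = Q"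
    "Q * real (card V) ^ 2 \<le> (\<Sum>x\<in>V. \<Sum>y\<in>V. w x y)"
proof -
  define q where "q m = (\<Sum>x\<in>V. \<Sum>y\<in>V. m x * m y * w x y)" for m
  define B where "B = {m. (\<forall>x\<in>V. 0 \<le> m x \<and> m x \<le> (1::real)) \<and> (\<forall>x. x \<notin> V \<longrightarrow> m x = 0)}"
  define S where "S = B \<inter> {m. (\<Sum>x\<in>V. m x) = 1}"
  have "closed {m. (\<Sum>x\<in>V. m x) = (1::real)}"
    by (intro closed_Collect_eq continuous_on_sum continuous_on_coordinate continuous_on_const)
  then have "compact S"
    unfolding S_def B_def using compact_function_box by (rule compact_Int_closed[rotated])
  define k where "k = real (card V)"
  have k: "0 < k" unfolding k_def using fin ne by (simp add: card_gt_0_iff)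
  define u where "u x = (if x \<in> V then 1 / k else 0)" for x
  have "1 \<le> k" using fin ne unfolding k_def by (simp add: Suc_leI card_gt_0_iff)
  then have u: "u \<in> S"
    using k unfolding S_def B_def u_def by (simp add: k_def[symmetric])
  moreover have "continuous_on S q"
    unfolding q_def by (intro continuous_intros continuous_on_coordinate)
  ultimately obtain m where m: "m \<in> S" "\<And>m'. m' \<in> S \<Longrightarrow> q m \<le> q m'"
    using continuous_attains_inf[OF \<open>compact S\<close>, of q] by blast
  have m0: "0 \<le> m x" if "x \<in> V" for x using m(1) that by (simp add: S_def B_def)
  have m1: "(\<Sum>x\<in>V. m x) = 1" using m(1) by (simp add: S_def)
  define g where "g x = (\<Sum>y\<in>V. m y * w x y)" for x
  have q_g: "q m = (\<Sum>x\<in>V. m x * g x)"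
    unfolding q_def g_def by (simp add: sum_distrib_left mult_ac)
  have le: "g x \<le> g y" if x: "x \<in> V" "0 < m x" and y: "y \<in> V" for x y
  proof (cases "x = y")
    case False
    have "2 * (g x - g y) \<le> 0"
    proof (rule nonpos_if_small_multiples[OF x(2)])
      fix t assume t: "0 < t" "t \<le> m x"
      define A where "A = w x x + w y y - 2 * w x y"
      define r where "r z = (if z = y then t else 0) - (if z = x then t else 0)" for z
      have rsum: "(\<Sum>z\<in>V. r z * c z) = t * (c y - c x)" for c :: "'a \<Rightarrow> real"
        unfolding r_def using fin x y
        by (simp add: left_diff_distrib sum_subtractf if_distrib[of "\<lambda>a. a * _"] sum.delta right_diff_distrib cong: if_cong)
      define m' where "m' z = m z + r z" for z
      have sum1: "(\<Sum>z\<in>V. m' z) = 1"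
        unfolding m'_def using rsum[of "\<lambda>_. 1"] m1 by (simp add: sum.distrib)
      have pos: "0 \<le> m' z" if "z \<in> V" for z
        using m0[OF that] t False unfolding m'_def r_def by auto
      have "m' z \<le> 1" if "z \<in> V" for z
        using member_le_sum[OF that _ fin, of m'] pos sum1 by auto
      moreover have "m' z = 0" if "z \<notin> V" for z
        using m(1) that x y unfolding m'_def r_def S_def B_def by auto
      ultimately have "m' \<in> S" using pos sum1 unfolding S_def B_def by simp
      then have "q m \<le> q m'" by (rule m(2))
      also have "q m' = q m + 2 * (\<Sum>z\<in>V. r z * g z) + (\<Sum>z\<in>V. r z * (\<Sum>v\<in>V. r v * w z v))"
      proof -
        have "q m' = (\<Sum>z\<in>V. \<Sum>v\<in>V. m z * m v * w z v) + (\<Sum>z\<in>V. \<Sum>v\<in>V. r z * (m v * w z v))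
            + (\<Sum>z\<in>V. \<Sum>v\<in>V. r v * (m z * w v z)) + (\<Sum>z\<in>V. \<Sum>v\<in>V. r z * (r v * w z v))"
          unfolding q_def m'_def by (simp add: sum.distrib[symmetric] algebra_simps wsym)
        also have "(\<Sum>z\<in>V. \<Sum>v\<in>V. r v * (m z * w v z)) = (\<Sum>z\<in>V. \<Sum>v\<in>V. r z * (m v * w z v))"
          by (rule sum.swap)
        finally show ?thesis unfolding q_def g_def by (simp add: sum_distrib_left)
      qed
      also have "\<dots> = q m + (2 * t * (g y - g x) + t * t * A)"
        unfolding rsum A_def by (simp add: wsym[of y x] algebra_simps)
      finally show "t * (2 * (g x - g y)) \<le> t * t * A" by (simp add: algebra_simps)
    qed
    then show ?thesis by simp
  qed simp
  obtain x0 where x0: "x0 \<in> V" "0 < m x0"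
    using m1 m0 by (metis less_eq_real_def sum.neutral zero_neq_one)
  have eq: "g x = g x0" if "x \<in> V" "0 < m x" for x
    using le[OF that x0(1)] le[OF x0 that(1)] by simp
  have "q m = (\<Sum>x\<in>V. m x * g x0)"
    unfolding q_g using eq m0 by (intro sum.cong refl) (metis less_eq_real_def mult_zero_left)
  then have "g x0 = q m" using m1 by (simp add: sum_distrib_right[symmetric])
  also have "\<dots> \<le> q u" by (rule m(2)[OF u])
  also have "\<dots> = (\<Sum>x\<in>V. \<Sum>y\<in>V. w x y) / k ^ 2"
    unfolding q_def u_def by (simp add: sum_divide_distrib power2_eq_square)
  finally have "g x0 * k ^ 2 \<le> (\<Sum>x\<in>V. \<Sum>y\<in>V. w x y)"
    using k by (simp add: field_simps)
  then show thesis
    using that[of m "g x0"] m0 m1 eq unfolding g_def k_def by blast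
qed

lemma sum_ordered_pairs_eq_edges:
  fixes w :: "'a set \<Rightarrow> real"
  assumes V: "finite V" and E: "E \<subseteq> nsets V 2"
  shows "(\<Sum>x\<in>V. \<Sum>y\<in>V. if {x, y} \<in> E then w {x, y} else 0) = 2 * (\<Sum>e\<in>E. w e)"
proof -
  let ?P = "{(x, y) \<in> V \<times> V. {x, y} \<in> E}"
  have "finite E" using E V by (meson finite_imp_finite_nsets finite_subset)
  have "(\<Sum>x\<in>V. \<Sum>y\<in>V. if {x, y} \<in> E then w {x, y} else 0) = (\<Sum>(x, y)\<in>?P. w {x, y})"
    unfolding sum.cartesian_product using V
    by (intro sum.mono_neutral_cong_right) (auto split: if_splits)
  also have "\<dots> = (\<Sum>e\<in>E. \<Sum>p\<in>{p \<in> ?P. {fst p, snd p} = e}. w {fst p, snd p})"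
    using V \<open>finite E\<close> by (subst sum.group) (auto simp: case_prod_unfold intro: finite_subset[of _ "V \<times> V"])
  also have "\<dots> = (\<Sum>e\<in>E. 2 * w e)"
  proof (rule sum.cong[OF refl])
    fix e assume e: "e \<in> E"
    then obtain x y where xy: "e = {x, y}" "x \<in> V" "y \<in> V" "x \<noteq> y" using E nsets2_E by blast
    then have "{p \<in> ?P. {fst p, snd p} = e} = {(x, y), (y, x)}"
      using e by (auto simp: doubleton_eq_iff insert_commute[of y x])
    then show "(\<Sum>p\<in>{p \<in> ?P. {fst p, snd p} = e}. w {fst p, snd p}) = 2 * w e"
      using xy by (simp add: insert_commute[of y x])
  qed
  finally show ?thesis by (simp add: sum_distrib_left)
qed

text \<open>Putting weight \<open>1\<close> on every loop extends a fractional triangle cover to triples with repeated vertices, at a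
  cost of only \<open>card V\<close>; this is the source of the linear error term.\<close>

lemma fractional_cover_bound:
  fixes w :: "'a set \<Rightarrow> real"
  assumes G: "simple_graph V E" and co: "co_triangle_free V E" and ne: "V \<noteq> {}"
    and w0: "\<And>e. 0 \<le> w e" and cover: "\<And>T. T \<in> triangles E \<Longrightarrow> 1 \<le> (\<Sum>e\<in>T. w e)"
  shows "real (card V) ^ 2 / 12 - real (card V) / 2 \<le> (\<Sum>e\<in>E. w e)"
proof -
  have fin: "finite V" and E: "E \<subseteq> nsets V 2" using G by (auto simp: simple_graph_def)
  define W where "W x y = (if x = y then 1 else if {x, y} \<in> E then w {x, y} else 0)" for x y
  define H where "H x y \<longleftrightarrow> x \<in> V \<and> y \<in> V \<and> x \<noteq> y \<and> {x, y} \<notin> E" for x y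
  have Wsym: "W x y = W y x" for x y unfolding W_def by (simp add: insert_commute)
  obtain m Q where m0: "\<And>x. x \<in> V \<Longrightarrow> 0 \<le> m x" and m1: "(\<Sum>x\<in>V. m x) = 1"
    and deg: "\<And>x. x \<in> V \<Longrightarrow> 0 < m x \<Longrightarrow> (\<Sum>y\<in>V. m y * W x y) = Q"
    and Q: "Q * real (card V) ^ 2 \<le> (\<Sum>x\<in>V. \<Sum>y\<in>V. W x y)"
    using ex_equalizing_weights[of V W, OF fin ne Wsym] by blast
  \<comment> \<open>Vertices of weight \<open>0\<close> need not have \<open>w\<close>-degree \<open>Q\<close>, so they are discarded.\<close>
  define U where "U = {x \<in> V. 0 < m x}"
  have U: "sum c U = sum c V" if "\<And>x. x \<in> V \<Longrightarrow> m x = 0 \<Longrightarrow> c x = 0" for c :: "'a \<Rightarrow> real"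
    using fin m0 that unfolding U_def by (intro sum.mono_neutral_left) force+
  have "1/6 \<le> Q"
  proof (rule equalized_cover_value[of U m H W])
    show "finite U" using fin by (simp add: U_def)
    show "0 < m x" if "x \<in> U" for x using that by (simp add: U_def)
    show "sum m U = 1" using U m1 by simp
    show "H y x" if "H x y" for x y using that by (auto simp: H_def insert_commute)
    show "\<not> H x z" if "H x y" "H y z" for x y z
    proof
      assume "H x z"
      then have "{{x, y}, {y, z}, {x, z}} \<in> triangles (complement_edges V E)"
        using that unfolding H_def triangles_def complement_edges_def by auto
      then show False using co by (simp add: co_triangle_free_def)
    qed
    show "W x y = W y x" for x y by (rule Wsym)
    show "0 \<le> W x y" for x y using w0 by (simp add: W_def)
    show "W x y = 0" if "H x y" for x y using that by (simp add: W_def H_def)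
    show "1 \<le> W x y + W y z + W x z"
      if "x \<in> U" "y \<in> U" "z \<in> U" "\<not> H x y" "\<not> H y z" "\<not> H x z" for x y z
    proof (cases "x = y \<or> y = z \<or> x = z")
      case True
      then show ?thesis using w0 by (auto simp: W_def)
    next
      case False
      then have *: "{x, y} \<in> E" "{y, z} \<in> E" "{x, z} \<in> E"
        using that by (auto simp: U_def H_def)
      then have "{{x, y}, {y, z}, {x, z}} \<in> triangles E"
        using False unfolding triangles_def by blast
      from cover[OF this] show ?thesis using False * by (auto simp: W_def doubleton_eq_iff)
    qed
    show "(\<Sum>y\<in>U. m y * W x y) = Q" if "x \<in> U" for x
      using that deg by (subst U) (auto simp: U_def)
  qed
  then have "real (card V) ^ 2 / 6 \<le> (\<Sum>x\<in>V. \<Sum>y\<in>V. W x y)"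
    using Q mult_right_mono[of "1/6" Q "real (card V) ^ 2"] by simp
  also have "\<dots> = (\<Sum>x\<in>V. \<Sum>y\<in>V. (if x = y then 1 else 0) + (if {x, y} \<in> E then w {x, y} else 0))"
  proof (intro sum.cong refl)
    fix x y
    have "{x} \<notin> E" using E by (auto simp: nsets_def)
    then show "W x y = (if x = y then 1 else 0) + (if {x, y} \<in> E then w {x, y} else 0)"
      by (auto simp: W_def)
  qed
  also have "\<dots> = real (card V) + 2 * (\<Sum>e\<in>E. w e)"
    using fin by (simp add: sum.distrib sum_ordered_pairs_eq_edges[OF fin E])
  finally show ?thesis by simp
qed

section \<open>From fractional covers to fractional matchings\<close>

definition load :: "'a set set \<Rightarrow> ('a set \<Rightarrow> real) \<Rightarrow> 'a \<Rightarrow> real" where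
  "load \<T> \<phi> v = (\<Sum>T | T \<in> \<T> \<and> v \<in> T. \<phi> T)"

lemma sum_load:
  assumes X: "finite X" and sub: "\<And>T. T \<in> \<T> \<Longrightarrow> T \<subseteq> X"
  shows "(\<Sum>v\<in>X. c v * load \<T> \<phi> v) = (\<Sum>T\<in>\<T>. (\<Sum>v\<in>T. c v) * \<phi> T)"
proof -
  have \<T>: "finite \<T>" using X sub by (meson Pow_iff finite_Pow_iff finite_subset subsetI)
  have "(\<Sum>v\<in>X. c v * load \<T> \<phi> v) = (\<Sum>v\<in>X. \<Sum>T\<in>\<T>. if v \<in> T then c v * \<phi> T else 0)"
    unfolding load_def sum_distrib_left using \<T> by (simp add: sum.inter_filter)
  also have "\<dots> = (\<Sum>T\<in>\<T>. \<Sum>v\<in>X. if v \<in> T then c v * \<phi> T else 0)" by (rule sum.swap)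
  also have "\<dots> = (\<Sum>T\<in>\<T>. (\<Sum>v\<in>T. c v) * \<phi> T)"
    using sub X by (intro sum.cong refl) (simp add: sum.inter_restrict[symmetric] Int_absorb1 sum_distrib_right)
  finally show ?thesis .
qed

text \<open>Linear programming duality for hypergraph matchings, up to a factor \<open>1 + \<delta>\<close>, by a penalty method. Maximise the total
  weight minus a quadratic penalty for loads above \<open>1\<close>. The penalty's slope \<open>w v\<close> at each point is then a
  fractional cover (\<open>up\<close>), tight on every hyperedge of positive weight (\<open>down\<close>). Complementary slackness
  bounds the total weight below by that of the cover, and tightness gives \<open>w v \<le> 1\<close>,
  which says that no load exceeds \<open>1 + \<delta>\<close>.\<close>

lemma fractional_matching_of_cover_bound:
  fixes X :: "'a set" and \<T> :: "'a set set"
  assumes X: "finite X" and sub: "\<And>T. T \<in> \<T> \<Longrightarrow> T \<subseteq> X" and ne: "{} \<notin> \<T>" and \<delta>: "0 < \<delta>"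
    and cover: "\<And>w. (\<And>v. 0 \<le> w v) \<Longrightarrow> (\<And>T. T \<in> \<T> \<Longrightarrow> 1 \<le> (\<Sum>v\<in>T. w v)) \<Longrightarrow> \<tau> \<le> (\<Sum>v\<in>X. w v)"
  obtains \<phi> :: "'a set \<Rightarrow> real"
  where "\<And>T. 0 \<le> \<phi> T" "\<And>T. T \<notin> \<T> \<Longrightarrow> \<phi> T = 0"
    "\<And>v. v \<in> X \<Longrightarrow> load \<T> \<phi> v \<le> 1" "\<tau> / (1 + \<delta>) \<le> (\<Sum>T\<in>\<T>. \<phi> T)"
proof -
  have \<T>: "finite \<T>" using X sub by (meson Pow_iff finite_Pow_iff finite_subset subsetI)
  \<comment> \<open>The cap \<open>b\<close> only makes the domain compact. It is so large that a hyperedge reaching it would consist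
    of points of slope at least \<open>2\<close>.\<close>
  define b where "b = 1 + 2 * \<delta>"
  define B where "B = {\<phi>. (\<forall>T\<in>\<T>. 0 \<le> \<phi> T \<and> \<phi> T \<le> b) \<and> (\<forall>T. T \<notin> \<T> \<longrightarrow> \<phi> T = 0)}"
  define pos where "pos a = max 0 (a - 1)" for a :: real
  define F where "F \<phi> = (\<Sum>T\<in>\<T>. \<phi> T) - (\<Sum>v\<in>X. (pos (load \<T> \<phi> v))\<^sup>2) / (2 * \<delta>)" for \<phi>
  have "compact B" unfolding B_def by (rule compact_function_box)
  moreover have "(\<lambda>_. 0) \<in> B" using \<delta> unfolding B_def b_def by simp
  moreover have "continuous_on B F"
    unfolding F_def pos_def load_def using \<delta>
    by (intro continuous_intros continuous_on_coordinate) simp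
  ultimately obtain \<phi> where \<phi>: "\<phi> \<in> B" "\<And>\<phi>'. \<phi>' \<in> B \<Longrightarrow> F \<phi>' \<le> F \<phi>"
    using continuous_attains_sup[of B F] by blast
  have \<phi>0: "0 \<le> \<phi> T" for T using \<phi>(1) unfolding B_def by (cases "T \<in> \<T>") auto
  define w where "w v = pos (load \<T> \<phi> v) / \<delta>" for v
  have w0: "0 \<le> w v" for v using \<delta> unfolding w_def pos_def by simp
  have pos_step: "(pos (a + t))\<^sup>2 \<le> (pos a)\<^sup>2 + 2 * t * pos a + t\<^sup>2" for a t :: real
  proof (cases "1 \<le> a")
    case True
    then have "(pos a)\<^sup>2 + 2 * t * pos a + t\<^sup>2 = (a + t - 1)\<^sup>2"
      by (simp add: pos_def power2_eq_square algebra_simps)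
    moreover have "(pos (a + t))\<^sup>2 \<le> (a + t - 1)\<^sup>2" by (simp add: pos_def max_def)
    ultimately show ?thesis by simp
  next
    case False
    then have "\<bar>pos (a + t)\<bar> \<le> \<bar>t\<bar>" "pos a = 0" by (auto simp: pos_def max_def)
    then show ?thesis using abs_le_square_iff by force
  qed
  have step: "t * (1 - (\<Sum>v\<in>T. w v)) \<le> t * t * (card T / (2 * \<delta>))"
    if T: "T \<in> \<T>" and t: "0 \<le> \<phi> T + t" "\<phi> T + t \<le> b" for T t
  proof -
    define \<phi>' where "\<phi>' = \<phi>(T := \<phi> T + t)"
    have "\<phi>' \<in> B" using \<phi>(1) T t unfolding \<phi>'_def B_def by auto
    then have F_le: "F \<phi>' \<le> F \<phi>" by (rule \<phi>(2))
    have total': "(\<Sum>S\<in>\<T>. \<phi>' S) = (\<Sum>S\<in>\<T>. \<phi> S) + t"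
      using sum.remove[OF \<T> T, of \<phi>] sum.remove[OF \<T> T, of \<phi>'] unfolding \<phi>'_def by simp
    have load': "load \<T> \<phi>' v = load \<T> \<phi> v + (if v \<in> T then t else 0)" for v
    proof (cases "v \<in> T")
      case True
      then have "T \<in> {S \<in> \<T>. v \<in> S}" "finite {S \<in> \<T>. v \<in> S}" using T \<T> by auto
      from sum.remove[OF this(2,1), of \<phi>] sum.remove[OF this(2,1), of \<phi>']
      show ?thesis unfolding load_def using True by (simp add: \<phi>'_def)
    next
      case False
      then show ?thesis unfolding load_def \<phi>'_def by (auto intro: sum.cong)
    qed
    have sq: "(\<Sum>v\<in>X. (pos (load \<T> \<phi>' v))\<^sup>2) \<le> (\<Sum>v\<in>X. (pos (load \<T> \<phi> v))\<^sup>2)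
        + (\<Sum>v\<in>T. 2 * t * pos (load \<T> \<phi> v) + t\<^sup>2)"
    proof -
      have "(\<Sum>v\<in>X. (pos (load \<T> \<phi>' v))\<^sup>2)
          \<le> (\<Sum>v\<in>X. (pos (load \<T> \<phi> v))\<^sup>2 + (if v \<in> T then 2 * t * pos (load \<T> \<phi> v) + t\<^sup>2 else 0))"
        using pos_step by (intro sum_mono) (simp add: load' add.assoc)
      also have "\<dots> = (\<Sum>v\<in>X. (pos (load \<T> \<phi> v))\<^sup>2) + (\<Sum>v\<in>X \<inter> T. 2 * t * pos (load \<T> \<phi> v) + t\<^sup>2)"
        unfolding sum.inter_restrict[OF X] by (rule sum.distrib)
      also have "X \<inter> T = T" using sub[OF T] by blast
      finally show ?thesis .
    qed
    have "t \<le> ((\<Sum>v\<in>X. (pos (load \<T> \<phi>' v))\<^sup>2) - (\<Sum>v\<in>X. (pos (load \<T> \<phi> v))\<^sup>2)) / (2 * \<delta>)"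
      using F_le unfolding F_def total' diff_divide_distrib by linarith
    also have "\<dots> \<le> (\<Sum>v\<in>T. 2 * t * pos (load \<T> \<phi> v) + t\<^sup>2) / (2 * \<delta>)"
      using sq \<delta> by (intro divide_right_mono) auto
    also have "\<dots> = t * (\<Sum>v\<in>T. w v) + t * t * (card T / (2 * \<delta>))"
      unfolding w_def using \<delta>
      by (simp add: sum.distrib sum_distrib_left sum_divide_distrib power2_eq_square add_divide_distrib)
    finally show ?thesis by (simp add: algebra_simps)
  qed
  have up: "1 \<le> (\<Sum>v\<in>T. w v)" if T: "T \<in> \<T>" "\<phi> T < b" for T
  proof -
    have "1 - (\<Sum>v\<in>T. w v) \<le> 0"
    proof (rule nonpos_if_small_multiples)
      show "0 < b - \<phi> T" using T by simp
      fix t assume "0 < t" "t \<le> b - \<phi> T"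
      then show "t * (1 - (\<Sum>v\<in>T. w v)) \<le> t * t * (card T / (2 * \<delta>))"
        using \<phi>0 T(1) by (intro step) (auto simp: add_nonneg_nonneg)
    qed
    then show ?thesis by simp
  qed
  have down: "(\<Sum>v\<in>T. w v) \<le> 1" if T: "T \<in> \<T>" "0 < \<phi> T" for T
  proof -
    have "(\<Sum>v\<in>T. w v) - 1 \<le> 0"
    proof (rule nonpos_if_small_multiples[OF T(2)])
      fix t assume t: "0 < t" "t \<le> \<phi> T"
      have "\<phi> T \<le> b" using \<phi>(1) T(1) unfolding B_def by blast
      then have "- t * (1 - (\<Sum>v\<in>T. w v)) \<le> - t * - t * (card T / (2 * \<delta>))"
        using t T(1) by (intro step) auto
      then show "t * ((\<Sum>v\<in>T. w v) - 1) \<le> t * t * (card T / (2 * \<delta>))" by (simp add: algebra_simps)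
    qed
    then show ?thesis by simp
  qed
  have finT: "finite T" if "T \<in> \<T>" for T using sub[OF that] X by (rule finite_subset)
  have w1: "w v \<le> 1" if v: "T \<in> \<T>" "v \<in> T" "0 < \<phi> T" for v T
    using member_le_sum[OF v(2) _ finT[OF v(1)], of w] w0 down[OF v(1,3)] by simp
  have "\<phi> T < b" if T: "T \<in> \<T>" for T
  proof (rule ccontr)
    assume b: "\<not> \<phi> T < b"
    obtain v where v: "v \<in> T" using T ne by (metis ex_in_conv)
    have "b \<le> load \<T> \<phi> v"
      using b member_le_sum[of T "{S \<in> \<T>. v \<in> S}" \<phi>] T v \<T> \<phi>0 unfolding load_def by simp
    then have "2 \<le> w v" using \<delta> unfolding w_def pos_def b_def by (simp add: field_simps)
    moreover have "0 < \<phi> T" using b \<delta> unfolding b_def by simp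
    ultimately show False using w1[OF T v] by simp
  qed
  then have "\<tau> \<le> (\<Sum>v\<in>X. w v)" using up w0 by (intro cover) auto
  \<comment> \<open>\<open>w v > 0\<close> only where the load is at least \<open>1\<close>\<close>
  also have "\<dots> \<le> (\<Sum>v\<in>X. w v * load \<T> \<phi> v)"
  proof (rule sum_mono)
    fix v
    show "w v \<le> w v * load \<T> \<phi> v"
    proof (cases "1 \<le> load \<T> \<phi> v")
      case True
      from mult_left_mono[OF this w0[of v]] show ?thesis by simp
    qed (simp add: w_def pos_def)
  qed
  also have "\<dots> = (\<Sum>T\<in>\<T>. (\<Sum>v\<in>T. w v) * \<phi> T)" using X sub by (rule sum_load)
  also have "\<dots> \<le> (\<Sum>T\<in>\<T>. \<phi> T)"
  proof (rule sum_mono)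
    fix T assume T: "T \<in> \<T>"
    show "(\<Sum>v\<in>T. w v) * \<phi> T \<le> \<phi> T"
    proof (cases "0 < \<phi> T")
      case True
      from mult_right_mono[OF down[OF T True] \<phi>0] show ?thesis by simp
    qed (use \<phi>0[of T] in simp)
  qed
  finally have total: "\<tau> \<le> (\<Sum>T\<in>\<T>. \<phi> T)" .
  have load1: "load \<T> \<phi> v \<le> 1 + \<delta>" for v
  proof (cases "\<exists>T\<in>\<T>. v \<in> T \<and> 0 < \<phi> T")
    case True
    then have "w v \<le> 1" using w1 by blast
    then show ?thesis using \<delta> unfolding w_def pos_def by (simp add: field_simps)
  next
    case False
    then have "\<phi> T = 0" if "T \<in> \<T>" "v \<in> T" for T using that \<phi>0[of T] by (metis less_eq_real_def)
    then have "load \<T> \<phi> v = 0" unfolding load_def by (intro sum.neutral) simp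
    then show ?thesis using \<delta> by simp
  qed
  show thesis
  proof (rule that[of "\<lambda>T. \<phi> T / (1 + \<delta>)"])
    show "0 \<le> \<phi> T / (1 + \<delta>)" for T using \<phi>0 \<delta> by simp
    show "\<phi> T / (1 + \<delta>) = 0" if "T \<notin> \<T>" for T using \<phi>(1) that unfolding B_def by simp
    show "load \<T> (\<lambda>T. \<phi> T / (1 + \<delta>)) v \<le> 1" for v
      using load1[of v] \<delta> unfolding load_def by (simp add: sum_divide_distrib[symmetric])
    show "\<tau> / (1 + \<delta>) \<le> (\<Sum>T\<in>\<T>. \<phi> T / (1 + \<delta>))"
      using total \<delta> by (simp add: sum_divide_distrib[symmetric] divide_right_mono)
  qed
qed

section \<open>Spread fractional triangle packings\<close>

lemma card_nsets_containing:
  assumes V: "finite V" and A: "A \<subseteq> V" "card A \<le> k"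
  shows "card {S \<in> nsets V k. A \<subseteq> S} = (card V - card A) choose (k - card A)"
proof -
  have fA: "finite A" using A V finite_subset by blast
  have "bij_betw (\<lambda>S. S - A) {S \<in> nsets V k. A \<subseteq> S} (nsets (V - A) (k - card A))"
  proof (rule bij_betwI[where g = "\<lambda>S. S \<union> A"])
    show "(\<lambda>S. S - A) \<in> {S \<in> nsets V k. A \<subseteq> S} \<rightarrow> nsets (V - A) (k - card A)"
      using fA by (auto simp: nsets_def card_Diff_subset)
    show "(\<lambda>S. S \<union> A) \<in> nsets (V - A) (k - card A) \<rightarrow> {S \<in> nsets V k. A \<subseteq> S}"
    proof
      fix S assume S: "S \<in> nsets (V - A) (k - card A)"
      then have "card (S \<union> A) = card S + card A"
        using fA by (intro card_Un_disjoint) (auto simp: nsets_def)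
      then show "S \<union> A \<in> {S \<in> nsets V k. A \<subseteq> S}"
        using S A fA by (auto simp: nsets_def)
    qed
  qed (auto simp: nsets_def)
  then have "card {S \<in> nsets V k. A \<subseteq> S} = card (nsets (V - A) (k - card A))" by (rule bij_betw_same_card)
  then show ?thesis using V A fA by (simp add: card_nsets card_Diff_subset)
qed

text \<open>The nibble needs a fractional packing in which no single triangle carries much weight. Averaging
  large fractional packings of all \<open>k\<close>-vertex induced subgraphs provides it: an edge lies in
  \<open>(n - 2) choose (k - 2)\<close> of these subgraphs, a triangle in only a fraction \<open>(k - 2) / (n - 2)\<close> of them. For fixed
  \<open>k\<close> the loss is of relative order \<open>1/k\<close>.\<close>

lemma spread_fractional_packing:
  fixes V :: "'a set"
  assumes G: "simple_graph V E" and co: "co_triangle_free V E"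
    and k: "3 \<le> k" "k \<le> card V"
  obtains \<phi> :: "'a set set \<Rightarrow> real"
  where "\<And>T. 0 \<le> \<phi> T" "\<And>T. T \<in> triangles E \<Longrightarrow> \<phi> T \<le> real (k - 2) / real (card V - 2)"
    "\<And>e. e \<in> E \<Longrightarrow> load (triangles E) \<phi> e \<le> 1"
    "real (card V) * (real (card V) - 1) * (1 / 12 - 1 / real k) \<le> (\<Sum>T\<in>triangles E. \<phi> T)"
proof -
  have V: "finite V" and E: "E \<subseteq> nsets V 2" using G by (auto simp: simple_graph_def)
  define n where "n = card V"
  have n: "3 \<le> n" using k unfolding n_def by simp
  define \<E> where "\<E> S = E \<inter> nsets S 2" for S
  define \<tau> where "\<tau> = (real k ^ 2 / 12 - real k / 2) / (1 + 1 / real k)"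
  have finE: "finite E" using finite_edges[OF G] .
  have tri_mono: "triangles (\<E> S) \<subseteq> triangles E" for S
    unfolding \<E>_def triangles_def by blast
  have fintri: "finite (triangles E)"
    using finE triangle_subset by (metis Pow_iff finite_Pow_iff finite_subset subsetI)
  define good where "good S \<phi> \<longleftrightarrow> (\<forall>T. 0 \<le> \<phi> T) \<and> (\<forall>T. T \<notin> triangles (\<E> S) \<longrightarrow> \<phi> T = 0)
      \<and> (\<forall>e\<in>\<E> S. load (triangles (\<E> S)) \<phi> e \<le> 1)
      \<and> \<tau> \<le> (\<Sum>T\<in>triangles (\<E> S). \<phi> T :: real)" for S \<phi>
  have "\<exists>\<phi>. good S \<phi>" if S: "S \<in> nsets V k" for S
  proof -
    have S': "S \<subseteq> V" "card S = k" "finite S" using S by (auto simp: nsets_def)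
    have G': "simple_graph S (\<E> S)" using S' by (simp add: simple_graph_def \<E>_def)
    have "complement_edges S (\<E> S) \<subseteq> complement_edges V E"
      using S'(1) nsets_mono[of S V 2] unfolding complement_edges_def \<E>_def by blast
    then have "triangles (complement_edges S (\<E> S)) \<subseteq> triangles (complement_edges V E)"
      unfolding triangles_def by blast
    then have co': "co_triangle_free S (\<E> S)" using co unfolding co_triangle_free_def by blast
    have "S \<noteq> {}" using S' k by auto
    obtain \<phi> :: "'a set set \<Rightarrow> real" where "\<And>T. 0 \<le> \<phi> T" "\<And>T. T \<notin> triangles (\<E> S) \<Longrightarrow> \<phi> T = 0"
      "\<And>e. e \<in> \<E> S \<Longrightarrow> load (triangles (\<E> S)) \<phi> e \<le> 1"
      "\<tau> \<le> (\<Sum>T\<in>triangles (\<E> S). \<phi> T)"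
    proof (rule fractional_matching_of_cover_bound[of "\<E> S" "triangles (\<E> S)" "1 / real k"
          "real k ^ 2 / 12 - real k / 2"])
      show "finite (\<E> S)" using finite_edges[OF G'] .
      show "T \<subseteq> \<E> S" if "T \<in> triangles (\<E> S)" for T using that by (rule triangle_subset)
      show "{} \<notin> triangles (\<E> S)" by (auto simp: triangles_def)
      show "0 < 1 / real k" using k by simp
      show "real k ^ 2 / 12 - real k / 2 \<le> (\<Sum>v\<in>\<E> S. w v)"
        if "\<And>v. 0 \<le> w v" "\<And>T. T \<in> triangles (\<E> S) \<Longrightarrow> 1 \<le> sum w T" for w :: "'a set \<Rightarrow> real"
        using fractional_cover_bound[OF G' co' \<open>S \<noteq> {}\<close> that] S' by simp
    qed (use \<tau>_def in blast)
    then show ?thesis unfolding good_def by blast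
  qed
  then obtain \<Phi> where "\<And>S. S \<in> nsets V k \<Longrightarrow> good S (\<Phi> S)" by metis
  then have \<Phi>: "\<And>S T. S \<in> nsets V k \<Longrightarrow> 0 \<le> \<Phi> S T"
    "\<And>S T. S \<in> nsets V k \<Longrightarrow> T \<notin> triangles (\<E> S) \<Longrightarrow> \<Phi> S T = 0"
    "\<And>S e. S \<in> nsets V k \<Longrightarrow> e \<in> \<E> S \<Longrightarrow> load (triangles (\<E> S)) (\<Phi> S) e \<le> 1"
    "\<And>S. S \<in> nsets V k \<Longrightarrow> \<tau> \<le> (\<Sum>T\<in>triangles (\<E> S). \<Phi> S T)"
    unfolding good_def by blast+
  define N where "N = nsets V k"
  have N: "finite N" unfolding N_def using V by (rule finite_imp_finite_nsets)
  define c where "c = (n - 2) choose (k - 2)"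
  have c: "0 < c" unfolding c_def using k n_def by simp
  define \<phi> where "\<phi> T = (\<Sum>S\<in>N. \<Phi> S T) / real c" for T
  have load: "load (triangles E) (\<Phi> S) e \<le> (if e \<subseteq> S then 1 else 0)"
    if S: "S \<in> N" and e: "e \<in> E" for S e
  proof -
    have S': "S \<in> nsets V k" using S by (simp add: N_def)
    have "load (triangles E) (\<Phi> S) e = load (triangles (\<E> S)) (\<Phi> S) e"
      unfolding load_def using fintri tri_mono[of S] \<Phi>(2)[OF S'] by (intro sum.mono_neutral_right) auto
    also have "\<dots> \<le> (if e \<subseteq> S then 1 else 0)"
    proof (cases "e \<subseteq> S")
      case True
      then have "e \<in> \<E> S" using e E unfolding \<E>_def nsets_def by auto
      then show ?thesis using \<Phi>(3)[OF S'] True by simp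
    next
      case False
      then have "{T. T \<in> triangles (\<E> S) \<and> e \<in> T} = {}"
        using triangle_subset unfolding \<E>_def nsets_def by fastforce
      then show ?thesis unfolding load_def by (simp only: sum.empty) simp
    qed
    finally show ?thesis .
  qed
  have \<Phi>1: "\<Phi> S T \<le> (if \<Union>T \<subseteq> S then 1 else 0)" if S: "S \<in> N" and T: "T \<in> triangles E" for S T
  proof (cases "\<Union>T \<subseteq> S")
    case True
    obtain e where e: "e \<in> T" using card_triangle[OF T] by fastforce
    have "e \<in> E" using triangle_subset[OF T] e by blast
    have "\<Phi> S T \<le> load (triangles E) (\<Phi> S) e"
      using fintri T e \<Phi>(1) S unfolding N_def load_def by (intro member_le_sum) auto
    also have "\<dots> \<le> 1" using load[OF S \<open>e \<in> E\<close>] by (auto split: if_splits)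
    finally show ?thesis using True by simp
  next
    case False
    then have "T \<notin> triangles (\<E> S)" using triangle_subset[of T "\<E> S"] unfolding \<E>_def nsets_def by auto
    then show ?thesis using \<Phi>(2) S False unfolding N_def by simp
  qed
  show thesis
  proof (rule that[of \<phi>])
    show "0 \<le> \<phi> T" for T unfolding \<phi>_def using \<Phi>(1) by (auto simp: N_def intro!: sum_nonneg divide_nonneg_nonneg)
    show "\<phi> T \<le> real (k - 2) / real (card V - 2)" if T: "T \<in> triangles E" for T
    proof -
      obtain x y z where xyz: "T = {{x, y}, {y, z}, {x, z}}" "x \<noteq> y" "y \<noteq> z" "x \<noteq> z" "{x, y} \<in> E" "{y, z} \<in> E"
        using T unfolding triangles_def by blast
      then have "\<Union>T \<subseteq> V" "card (\<Union>T) = 3" using E by (auto simp: card_insert_if)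
      then have card: "card {S \<in> N. \<Union>T \<subseteq> S} = (n - 3) choose (k - 3)"
        unfolding N_def n_def using card_nsets_containing[OF V, of "\<Union>T" k] k by simp
      have "(\<Sum>S\<in>N. \<Phi> S T) \<le> (\<Sum>S\<in>N. if \<Union>T \<subseteq> S then 1 else 0)"
        using \<Phi>1 T by (intro sum_mono) auto
      also have "\<dots> = real ((n - 3) choose (k - 3))"
        using N by (simp add: card[symmetric] sum.inter_filter[symmetric])
      finally have "\<phi> T \<le> real ((n - 3) choose (k - 3)) / real c" unfolding \<phi>_def by (simp add: divide_right_mono)
      also have "\<dots> = real (k - 2) / real (n - 2)"
      proof -
        have "(k - 2) * c = (n - 2) * ((n - 3) choose (k - 3))"
          using times_binomial_minus1_eq[of "k - 2" "n - 2"] k unfolding c_def by simp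
        then have "real (k - 2) * real c = real (n - 2) * real ((n - 3) choose (k - 3))"
          by (metis of_nat_mult)
        then show ?thesis using c n by (simp add: field_simps)
      qed
      finally show ?thesis unfolding n_def .
    qed
    show "load (triangles E) \<phi> e \<le> 1" if e: "e \<in> E" for e
    proof -
      have "e \<subseteq> V" "card e = 2" using e E by (auto simp: nsets_def)
      then have card: "card {S \<in> N. e \<subseteq> S} = c"
        unfolding N_def c_def n_def using card_nsets_containing[OF V, of e k] k by simp
      have "(\<Sum>T | T \<in> triangles E \<and> e \<in> T. \<Sum>S\<in>N. \<Phi> S T) = (\<Sum>S\<in>N. \<Sum>T | T \<in> triangles E \<and> e \<in> T. \<Phi> S T)"
        by (rule sum.swap)
      also have "\<dots> \<le> (\<Sum>S\<in>N. if e \<subseteq> S then 1 else 0)"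
        using load[unfolded load_def] e by (intro sum_mono) auto
      also have "\<dots> = real c" using N by (simp add: card[symmetric] sum.inter_filter[symmetric])
      finally show ?thesis unfolding \<phi>_def load_def using c by (simp add: sum_divide_distrib[symmetric])
    qed
    have "real (card N) * \<tau> \<le> (\<Sum>S\<in>N. \<Sum>T\<in>triangles (\<E> S). \<Phi> S T)"
      using sum_mono[of N "\<lambda>_. \<tau>" "\<lambda>S. \<Sum>T\<in>triangles (\<E> S). \<Phi> S T"] \<Phi>(4) unfolding N_def by simp
    also have "\<dots> = (\<Sum>S\<in>N. \<Sum>T\<in>triangles E. \<Phi> S T)"
      using fintri tri_mono \<Phi>(2) unfolding N_def
      by (intro sum.cong refl sum.mono_neutral_left) auto
    also have "\<dots> = (\<Sum>T\<in>triangles E. \<Sum>S\<in>N. \<Phi> S T)" by (rule sum.swap)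
    finally have low: "real (card N) / real c * \<tau> \<le> (\<Sum>T\<in>triangles E. \<phi> T)"
      unfolding \<phi>_def using c by (simp add: sum_divide_distrib[symmetric] divide_right_mono)
    have ratio: "real (card N) / real c = real n * (real n - 1) / (real k * (real k - 1))"
    proof -
      have "k * (k - 1) * card N = (k - 1) * (k * (n choose k))"
        unfolding N_def n_def using V by (simp add: card_nsets)
      also have "\<dots> = n * ((k - 1) * ((n - 1) choose (k - 1)))"
        using times_binomial_minus1_eq[of k n] k by simp
      also have "\<dots> = n * (n - 1) * c"
        using times_binomial_minus1_eq[of "k - 1" "n - 1"] k unfolding c_def by (simp add: numeral_2_eq_2)
      finally have "k * (k - 1) * card N = n * (n - 1) * c" .
      then have "real (k * (k - 1) * card N) = real (n * (n - 1) * c)" by simp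
      then have "real k * (real k - 1) * real (card N) = real n * (real n - 1) * real c"
        using k n by (simp add: of_nat_diff)
      moreover have "real k * (real k - 1) \<noteq> 0" using k by simp
      ultimately show ?thesis using c by (simp add: frac_eq_eq mult.commute)
    qed
    have "1 / 12 - 1 / real k \<le> \<tau> / (real k * (real k - 1))"
    proof -
      have k3: "3 \<le> real k" using k by simp
      have eq: "\<tau> / (real k * (real k - 1)) = (real k ^ 2 / 12 - real k / 2) / (real k ^ 2 - 1)"
      proof -
        have "(1 + 1 / real k) * (real k * (real k - 1)) = real k ^ 2 - 1"
          using k3 by (simp add: field_simps power2_eq_square)
        then show ?thesis unfolding \<tau>_def divide_divide_eq_left by simp
      qed
      have "(1 / 12 - 1 / real k) * (real k ^ 2 - 1) \<le> real k ^ 2 / 12 - real k / 2"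
      proof -
        have "(1 / 12 - 1 / real k) * (real k ^ 2 - 1) = real k ^ 2 / 12 - real k - 1 / 12 + 1 / real k"
          using k3 by (simp add: field_simps power2_eq_square)
        moreover have "1 / real k \<le> 1" using k3 by simp
        ultimately show ?thesis using k3 by linarith
      qed
      moreover have "0 < real k ^ 2 - 1" using k3 by (simp add: power2_eq_square less_1_mult)
      ultimately show ?thesis unfolding eq by (simp add: pos_le_divide_eq)
    qed
    then have "real n * (real n - 1) * (1 / 12 - 1 / real k) \<le> real n * (real n - 1) * (\<tau> / (real k * (real k - 1)))"
      using n by (intro mult_left_mono) auto
    also have "\<dots> = real (card N) / real c * \<tau>" unfolding ratio by (simp only: times_divide_eq_left times_divide_eq_right)
    finally show "real (card V) * (real (card V) - 1) * (1 / 12 - 1 / real k) \<le> (\<Sum>T\<in>triangles E. \<phi> T)"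
      unfolding n_def[symmetric] using low by (rule order_trans)
  qed
qed

section \<open>Random subsets\<close>

text \<open>The expectation of \<open>F R\<close> for the random subset \<open>R\<close> of \<open>I\<close> that contains each \<open>i\<close> independently with
  probability \<open>p i\<close>.\<close>

definition expect :: "('i \<Rightarrow> real) \<Rightarrow> 'i set \<Rightarrow> ('i set \<Rightarrow> real) \<Rightarrow> real" where
  "expect p I F = (\<Sum>R\<in>Pow I. (\<Prod>i\<in>R. p i) * (\<Prod>i\<in>I - R. 1 - p i) * F R)"

lemma expect_add: "expect p I (\<lambda>R. F R + G R) = expect p I F + expect p I G"
  unfolding expect_def by (simp add: distrib_left sum.distrib)

lemma expect_cmult: "expect p I (\<lambda>R. c * F R) = c * expect p I F"
  unfolding expect_def by (simp add: sum_distrib_left mult_ac)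

lemma expect_diff: "expect p I (\<lambda>R. F R - G R) = expect p I F - expect p I G"
  unfolding expect_def by (simp add: right_diff_distrib sum_subtractf)

lemma expect_sum: "expect p I (\<lambda>R. \<Sum>a\<in>A. F a R) = (\<Sum>a\<in>A. expect p I (F a))"
  unfolding expect_def by (subst sum.swap) (simp add: sum_distrib_left)

lemma expect_cong: "(\<And>R. R \<subseteq> I \<Longrightarrow> F R = G R) \<Longrightarrow> expect p I F = expect p I G"
  unfolding expect_def by simp

lemma expect_avoid:
  assumes I: "finite I" and J: "J \<subseteq> I"
  shows "expect p I (\<lambda>R. of_bool (R \<inter> J = {})) = (\<Prod>i\<in>J. 1 - p i)"
proof -
  define q where "q i = (if i \<in> J then 0 else p i)" for i
  have "expect p I (\<lambda>R. of_bool (R \<inter> J = {})) = (\<Sum>R\<in>Pow I. (\<Prod>i\<in>R. q i) * (\<Prod>i\<in>I - R. 1 - p i))"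
    unfolding expect_def
  proof (rule sum.cong[OF refl])
    fix R assume "R \<in> Pow I"
    then have R: "finite R" using I by (auto intro: finite_subset)
    have "(\<Prod>i\<in>R. q i) = (\<Prod>i\<in>R. p i) * of_bool (R \<inter> J = {})"
    proof (cases "R \<inter> J = {}")
      case True
      then show ?thesis by (auto simp: q_def intro!: prod.cong)
    next
      case False
      then have "\<exists>i\<in>R. q i = 0" by (auto simp: q_def)
      then show ?thesis using R False by simp
    qed
    then show "(\<Prod>i\<in>R. p i) * (\<Prod>i\<in>I - R. 1 - p i) * of_bool (R \<inter> J = {})
        = (\<Prod>i\<in>R. q i) * (\<Prod>i\<in>I - R. 1 - p i)" by simp
  qed
  also have "\<dots> = (\<Prod>i\<in>I. q i + (1 - p i))" using prod_add[OF I] by metis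
  also have "\<dots> = (\<Prod>i\<in>J. q i + (1 - p i))"
    using I J by (intro prod.mono_neutral_right) (auto simp: q_def)
  finally show ?thesis by (simp add: q_def)
qed

lemma expect_const: "finite I \<Longrightarrow> expect p I (\<lambda>_. c) = c"
  using expect_avoid[of I "{}" p] expect_cmult[of p I c "\<lambda>_. 1"] by simp

lemma expect_pick_avoid:
  assumes I: "finite I" and i: "i \<in> I" "i \<notin> J" and J: "J \<subseteq> I"
  shows "expect p I (\<lambda>R. of_bool (i \<in> R \<and> R \<inter> J = {})) = p i * (\<Prod>j\<in>J. 1 - p j)"
proof -
  have "expect p I (\<lambda>R. of_bool (i \<in> R \<and> R \<inter> J = {}))
      = expect p I (\<lambda>R. of_bool (R \<inter> J = {}) - of_bool (R \<inter> insert i J = {}))"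
    by (intro expect_cong) auto
  also have "\<dots> = (\<Prod>j\<in>J. 1 - p j) - (\<Prod>j\<in>insert i J. 1 - p j)"
    using assms by (simp only: expect_diff expect_avoid insert_subset)
  also have "\<dots> = p i * (\<Prod>j\<in>J. 1 - p j)"
    using i finite_subset[OF J I] by (simp add: algebra_simps)
  finally show ?thesis .
qed

lemma expect_mono:
  assumes p: "\<And>i. i \<in> I \<Longrightarrow> 0 \<le> p i \<and> p i \<le> 1" and le: "\<And>R. R \<subseteq> I \<Longrightarrow> F R \<le> G R"
  shows "expect p I F \<le> expect p I G"
  unfolding expect_def using p le
  by (intro sum_mono mult_left_mono mult_nonneg_nonneg prod_nonneg) auto

lemma expect_attained:
  assumes I: "finite I" and p: "\<And>i. i \<in> I \<Longrightarrow> 0 \<le> p i \<and> p i \<le> 1" and a: "a \<le> expect p I F"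
  obtains R where "R \<subseteq> I" "a \<le> F R"
proof -
  have "finite (F ` Pow I)" "F ` Pow I \<noteq> {}" using I by auto
  then obtain R where "R \<in> Pow I" "Max (F ` Pow I) = F R" using Max_in by (metis imageE)
  moreover have "F S \<le> Max (F ` Pow I)" if "S \<subseteq> I" for S using that I by (intro Max_ge) auto
  ultimately have R: "R \<subseteq> I" "\<And>S. S \<subseteq> I \<Longrightarrow> F S \<le> F R" by auto
  have "expect p I F \<le> expect p I (\<lambda>_. F R)" using p R(2) by (rule expect_mono)
  then show thesis using that R(1) a expect_const[OF I] by (metis order_trans)
qed

section \<open>Rounding by the nibble method\<close>

lemma sum_UN_le:
  fixes f :: "'b \<Rightarrow> real"
  assumes "finite I" "\<And>i. i \<in> I \<Longrightarrow> finite (A i)" "\<And>i x. i \<in> I \<Longrightarrow> x \<in> A i \<Longrightarrow> 0 \<le> f x"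
  shows "sum f (\<Union>i\<in>I. A i) \<le> (\<Sum>i\<in>I. sum f (A i))"
  using assms
proof (induction I rule: finite_induct)
  case (insert i I)
  let ?B = "\<Union>i\<in>I. A i"
  have "sum f (A i \<union> ?B) + sum f (A i \<inter> ?B) = sum f (A i) + sum f ?B"
    using insert by (intro sum.union_inter) auto
  moreover have "0 \<le> sum f (A i \<inter> ?B)" using insert.prems by (intro sum_nonneg) auto
  moreover have "sum f ?B \<le> (\<Sum>i\<in>I. sum f (A i))" using insert by auto
  ultimately show ?case using insert.hyps by simp
qed simp

text \<open>Dividing the weight of each hyperedge by those loads of its points that exceed \<open>1\<close> repairs every overload; the
  Weierstrass product inequality shows that this costs no more than the total overload.\<close>

lemma trim_overload:
  assumes X: "finite X" and sub: "\<And>T. T \<in> \<T> \<Longrightarrow> T \<subseteq> X" and \<phi>: "\<And>T. T \<in> \<T> \<Longrightarrow> 0 \<le> \<phi> T"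
  obtains \<psi> where "\<And>T. T \<in> \<T> \<Longrightarrow> 0 \<le> \<psi> T \<and> \<psi> T \<le> \<phi> T" "\<And>v. v \<in> X \<Longrightarrow> load \<T> \<psi> v \<le> 1"
    "(\<Sum>T\<in>\<T>. \<phi> T) - (\<Sum>v\<in>X. max 0 (load \<T> \<phi> v - 1)) \<le> (\<Sum>T\<in>\<T>. \<psi> T)"
proof -
  define k where "k v = 1 / max 1 (load \<T> \<phi> v)" for v
  have k: "0 \<le> k v" "k v \<le> 1" for v unfolding k_def by (auto simp: field_simps)
  define \<psi> where "\<psi> T = (\<Prod>v\<in>T. k v) * \<phi> T" for T
  have prod1: "(\<Prod>v\<in>S. k v) \<le> 1" for S using k by (intro prod_le_1) auto
  show thesis
  proof (rule that[of \<psi>])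
    show "0 \<le> \<psi> T \<and> \<psi> T \<le> \<phi> T" if "T \<in> \<T>" for T
      unfolding \<psi>_def using \<phi>[OF that] prod1[of T] k by (auto intro!: mult_nonneg_nonneg prod_nonneg mult_left_le_one_le)
    show "load \<T> \<psi> v \<le> 1" if "v \<in> X" for v
    proof -
      have "load \<T> \<psi> v \<le> (\<Sum>T | T \<in> \<T> \<and> v \<in> T. k v * \<phi> T)"
        unfolding load_def
      proof (rule sum_mono)
        fix T assume T: "T \<in> {T \<in> \<T>. v \<in> T}"
        then have "finite T" using sub X finite_subset by blast
        then have "(\<Prod>u\<in>T. k u) = k v * (\<Prod>u\<in>T - {v}. k u)" using T by (simp add: prod.remove)
        also have "\<dots> \<le> k v" using prod1[of "T - {v}"] k by (intro mult_left_le) auto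
        finally show "\<psi> T \<le> k v * \<phi> T" unfolding \<psi>_def using \<phi> T by (intro mult_right_mono) auto
      qed
      also have "\<dots> = k v * load \<T> \<phi> v" unfolding load_def by (simp add: sum_distrib_left)
      also have "\<dots> \<le> 1" unfolding k_def by (simp add: max_def)
      finally show ?thesis .
    qed
    have "(\<Sum>v\<in>X. (1 - k v) * load \<T> \<phi> v) = (\<Sum>T\<in>\<T>. (\<Sum>v\<in>T. 1 - k v) * \<phi> T)"
      using X sub by (rule sum_load)
    then have "(\<Sum>T\<in>\<T>. \<phi> T) - (\<Sum>v\<in>X. (1 - k v) * load \<T> \<phi> v) = (\<Sum>T\<in>\<T>. \<phi> T - (\<Sum>v\<in>T. 1 - k v) * \<phi> T)"
      by (simp only: sum_subtractf)
    also have "\<dots> = (\<Sum>T\<in>\<T>. (1 - (\<Sum>v\<in>T. 1 - k v)) * \<phi> T)"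
      by (rule sum.cong[OF refl]) (simp only: left_diff_distrib mult_1)
    also have "\<dots> \<le> (\<Sum>T\<in>\<T>. \<psi> T)"
      unfolding \<psi>_def
    proof (intro sum_mono mult_right_mono)
      fix T
      show "1 - (\<Sum>v\<in>T. 1 - k v) \<le> (\<Prod>v\<in>T. k v)"
        using Weierstrass_prod_ineq[of T "\<lambda>v. 1 - k v"] k by simp
    qed (rule \<phi>)
    also have "(\<Sum>v\<in>X. (1 - k v) * load \<T> \<phi> v) = (\<Sum>v\<in>X. max 0 (load \<T> \<phi> v - 1))"
      by (intro sum.cong refl) (auto simp: k_def max_def field_simps)
    finally show "(\<Sum>T\<in>\<T>. \<phi> T) - (\<Sum>v\<in>X. max 0 (load \<T> \<phi> v - 1)) \<le> (\<Sum>T\<in>\<T>. \<psi> T)" .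
  qed
qed

text \<open>Systems of triples in which two triples share at most one point, with a fractional matching whose weights are
  all at most \<open>\<eta>\<close>. Edge-disjoint triangle packings are matchings of such a system, the points being the edges of
  the graph.\<close>

definition spread_system :: "'a set \<Rightarrow> 'a set set \<Rightarrow> ('a set \<Rightarrow> real) \<Rightarrow> real \<Rightarrow> bool" where
  "spread_system X \<T> \<phi> \<eta> \<longleftrightarrow> finite X \<and> (\<forall>T\<in>\<T>. T \<subseteq> X \<and> card T = 3) \<and>
    (\<forall>S\<in>\<T>. \<forall>T\<in>\<T>. S \<noteq> T \<longrightarrow> card (S \<inter> T) \<le> 1) \<and>
    (\<forall>T\<in>\<T>. 0 \<le> \<phi> T \<and> \<phi> T \<le> \<eta>) \<and> (\<forall>v\<in>X. load \<T> \<phi> v \<le> 1)"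

text \<open>One bite of the nibble: choose each triple \<open>T\<close> with probability \<open>\<theta> \<phi> T\<close>, keep the chosen triples that meet no other
  chosen one, delete all points covered by chosen triples and some further random points, and continue with the triples that
  survive, their weights increased by a factor \<open>1 + 2 \<theta>\<close>. The errors made are of order \<open>\<theta>\<^sup>2\<close> per point; the requirement \<open>\<eta> \<le> \<theta> ^ 4\<close> makes
  the random fluctuations of that order, too.\<close>

locale bite =
  fixes X :: "'a set" and \<T> :: "'a set set" and \<phi> :: "'a set \<Rightarrow> real" and \<eta> \<theta> :: real
  assumes sys: "spread_system X \<T> \<phi> \<eta>"
    and \<theta>: "0 < \<theta>" "\<theta> \<le> 1/4" and \<eta>: "\<eta> \<le> \<theta> ^ 4" and \<eta>0: "0 \<le> \<eta>"
begin

lemma finite_X: "finite X" and T_sub: "T \<in> \<T> \<Longrightarrow> T \<subseteq> X" and card_T: "T \<in> \<T> \<Longrightarrow> card T = 3"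
  and \<phi>_bounds: "T \<in> \<T> \<Longrightarrow> 0 \<le> \<phi> T" "T \<in> \<T> \<Longrightarrow> \<phi> T \<le> \<eta>"
  and load_le_1: "v \<in> X \<Longrightarrow> load \<T> \<phi> v \<le> 1"
  using sys unfolding spread_system_def by auto

lemma finite_\<T>: "finite \<T>"
  using finite_X T_sub by (meson Pow_iff finite_Pow_iff finite_subset subsetI)

lemma finite_T: "T \<in> \<T> \<Longrightarrow> finite T"
  using T_sub finite_X finite_subset by blast

lemma linear:
  assumes "S \<in> \<T>" "T \<in> \<T>" "x \<in> S" "x \<in> T" "y \<in> S" "y \<in> T" "x \<noteq> y"
  shows "S = T"
proof (rule ccontr)
  assume "S \<noteq> T"
  then have "card (S \<inter> T) \<le> 1" using sys assms(1,2) unfolding spread_system_def by blast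
  moreover have "card {x, y} \<le> card (S \<inter> T)" using assms finite_T by (intro card_mono) auto
  ultimately show False using assms(7) by simp
qed

lemma load_nonneg: "0 \<le> load \<T> \<phi> v"
  unfolding load_def using \<phi>_bounds by (intro sum_nonneg) auto

lemma \<eta>_le_1: "\<eta> \<le> 1" and \<eta>_le: "\<eta> \<le> \<theta>\<^sup>2"
proof -
  have "\<theta> ^ 4 \<le> \<theta> ^ 2" using \<theta> by (intro power_decreasing) auto
  then show "\<eta> \<le> \<theta>\<^sup>2" using \<eta> by simp
  also have "\<theta>\<^sup>2 \<le> 1" using \<theta> by (simp add: power_le_one)
  finally show "\<eta> \<le> 1" .
qed

text \<open>Dummy singletons take up the slack in the loads, so that the probabilities of the items at a point always add up to
  \<open>\<theta>\<close>. All points then survive with nearly the same probability.\<close>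

definition items :: "'a set set" where "items = \<T> \<union> (\<lambda>v. {v}) ` X"
definition p :: "'a set \<Rightarrow> real" where
  "p S = \<theta> * (if S \<in> \<T> then \<phi> S else 1 - load \<T> \<phi> (the_elem S))"

lemma finite_items: "finite items"
  unfolding items_def using finite_\<T> finite_X by simp

lemma singleton_notin: "{v} \<notin> \<T>"
  using card_T by fastforce

lemma p_T: "T \<in> \<T> \<Longrightarrow> p T = \<theta> * \<phi> T"
  unfolding p_def by simp

lemma p_bounds: "S \<in> items \<Longrightarrow> 0 \<le> p S \<and> p S \<le> 1"
proof -
  assume S: "S \<in> items"
  have "0 \<le> p S \<and> p S \<le> \<theta> * 1"
    unfolding p_def using \<theta> S \<phi>_bounds \<eta>_le_1 load_nonneg load_le_1
    by (auto simp: items_def singleton_notin intro: mult_nonneg_nonneg order_trans)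
  then show ?thesis using \<theta> by simp
qed

lemma sum_p_at:
  assumes v: "v \<in> X"
  shows "(\<Sum>S | S \<in> items \<and> v \<in> S. p S) = \<theta>"
proof -
  have "{S. S \<in> items \<and> v \<in> S} = insert {v} {T. T \<in> \<T> \<and> v \<in> T}"
    unfolding items_def using v by auto
  then have "(\<Sum>S | S \<in> items \<and> v \<in> S. p S) = p {v} + (\<Sum>T | T \<in> \<T> \<and> v \<in> T. p T)"
    using singleton_notin finite_\<T> by simp
  also have "(\<Sum>T | T \<in> \<T> \<and> v \<in> T. p T) = \<theta> * load \<T> \<phi> v"
    unfolding load_def by (simp add: p_T sum_distrib_left)
  finally show ?thesis by (simp add: p_def singleton_notin algebra_simps)
qed

abbreviation E :: "('a set set \<Rightarrow> real) \<Rightarrow> real" where "E \<equiv> expect p items"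

lemmas E_mono = expect_mono[of items p, OF p_bounds]

lemma prod_lower:
  assumes "J \<subseteq> items"
  shows "1 - sum p J \<le> (\<Prod>S\<in>J. 1 - p S)"
  using assms p_bounds by (intro Weierstrass_prod_ineq) auto

lemma prod_upper:
  assumes J: "J \<subseteq> items"
  shows "(\<Prod>S\<in>J. 1 - p S) \<le> exp (- sum p J)"
proof -
  have "(\<Prod>S\<in>J. 1 - p S) \<le> (\<Prod>S\<in>J. exp (- p S))"
    using J p_bounds exp_ge_add_one_self[of "- p _"] by (intro prod_mono) (auto simp: subset_iff)
  also have "\<dots> = exp (- sum p J)"
    using finite_subset[OF J finite_items] by (simp add: exp_sum[symmetric] sum_negf)
  finally show ?thesis .
qed

lemma E_survive_vertex:
  assumes v: "v \<in> X"
  shows "E (\<lambda>R. of_bool (v \<notin> \<Union>R)) \<le> 1 - \<theta> / 2"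
proof -
  have "E (\<lambda>R. of_bool (v \<notin> \<Union>R)) = E (\<lambda>R. of_bool (R \<inter> {S \<in> items. v \<in> S} = {}))"
    by (intro expect_cong) auto
  also have "\<dots> \<le> exp (- \<theta>)"
    using prod_upper[of "{S \<in> items. v \<in> S}"] sum_p_at[OF v] finite_items by (simp add: expect_avoid)
  also have "\<dots> \<le> 1 / (1 + \<theta>)"
    using exp_ge_add_one_self[of \<theta>] \<theta> by (simp add: exp_minus field_simps)
  also have "\<dots> \<le> 1 - \<theta> / 2"
    using \<theta> by (simp add: field_simps)
  finally show ?thesis .
qed

definition hit :: "'a set \<Rightarrow> 'a set set" where "hit T = {S \<in> items. S \<inter> T \<noteq> {}}"

lemma hit_sub: "hit T \<subseteq> items" unfolding hit_def by blast

lemma sum_p_hit: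
  assumes T: "T \<in> \<T>"
  shows "sum p (hit T) \<le> 3 * \<theta>"
proof -
  have "hit T = (\<Union>v\<in>T. {S. S \<in> items \<and> v \<in> S})" unfolding hit_def by blast
  then have "sum p (hit T) \<le> (\<Sum>v\<in>T. \<Sum>S | S \<in> items \<and> v \<in> S. p S)"
    using p_bounds finite_items finite_T[OF T] by (simp only:) (intro sum_UN_le; force)
  also have "\<dots> = (\<Sum>v\<in>T. \<theta>)" using T_sub[OF T] by (intro sum.cong refl sum_p_at) auto
  finally show ?thesis using card_T[OF T] by simp
qed

lemma E_survive_triple:
  assumes T: "T \<in> \<T>"
  shows "1 - 3 * \<theta> \<le> E (\<lambda>R. of_bool (R \<inter> hit T = {}))"
  using prod_lower[OF hit_sub] sum_p_hit[OF T] finite_items hit_sub by (simp add: expect_avoid) (smt (verit))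

lemma E_isolated:
  assumes T: "T \<in> \<T>"
  shows "\<theta> * \<phi> T * (1 - 3 * \<theta>) \<le> E (\<lambda>R. of_bool (T \<in> R \<and> R \<inter> (hit T - {T}) = {}))"
proof -
  have Ti: "T \<in> items" using T by (simp add: items_def)
  have sub: "hit T - {T} \<subseteq> items" using hit_sub by blast
  have "sum p (hit T - {T}) \<le> sum p (hit T)"
    using finite_subset[OF hit_sub finite_items] p_bounds hit_sub by (intro sum_mono2) (auto simp: subset_iff)
  then have "1 - 3 * \<theta> \<le> (\<Prod>S\<in>hit T - {T}. 1 - p S)"
    using prod_lower[OF sub] sum_p_hit[OF T] by linarith
  then have "p T * (1 - 3 * \<theta>) \<le> p T * (\<Prod>S\<in>hit T - {T}. 1 - p S)"
    using p_bounds[OF Ti] by (intro mult_left_mono) auto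
  then show ?thesis
    using expect_pick_avoid[OF finite_items Ti _ sub] by (simp add: p_T[OF T])
qed

text \<open>\<open>J v T\<close> consists of the items that can destroy \<open>T\<close> without hitting \<open>v\<close>, and \<open>Y v\<close> is the weight at \<open>v\<close> of the
  triples not destroyed in this way. It dominates the surviving load at \<open>v\<close>, and unlike that load it does not
  depend on the fate of \<open>v\<close> itself. Each triple at \<open>v\<close> is threatened at its two other points, so the
  expectation of \<open>Y v\<close> is below the load by a factor of about \<open>1 - 2 \<theta>\<close>, which the increase of the weights
  compensates.\<close>

definition J :: "'a \<Rightarrow> 'a set \<Rightarrow> 'a set set" where "J v T = {S \<in> items. v \<notin> S \<and> S \<inter> T \<noteq> {}}"
definition Y :: "'a \<Rightarrow> 'a set set \<Rightarrow> real" where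
  "Y v R = (\<Sum>T | T \<in> \<T> \<and> v \<in> T. \<phi> T * of_bool (R \<inter> J v T = {}))"

lemma J_sub: "J v T \<subseteq> items" unfolding J_def by blast

text \<open>Only \<open>T\<close> itself contains both \<open>v\<close> and another point of \<open>T\<close>, or both of the other points; hence the items in
  \<open>J v T\<close> carry the full probability at both points, except for that of \<open>T\<close>.\<close>

lemma sum_p_J:
  assumes T: "T \<in> \<T>" and v: "v \<in> T"
  shows "2 * \<theta> * (1 - \<eta>) \<le> sum p (J v T)"
proof -
  obtain a b where ab: "T - {v} = {a, b}" "a \<noteq> b"
    using card_T[OF T] v finite_T[OF T] by (metis card_2_iff card_Diff_singleton diff_Suc_1 numeral_3_eq_3 numeral_2_eq_2)
  have T_eq: "T = {v, a, b}" using ab(1) v by blast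
  have star: "(\<Sum>S | S \<in> items \<and> u \<in> S \<and> v \<notin> S. p S) = \<theta> - p T" if u: "u \<in> T" "u \<noteq> v" for u
  proof -
    have "{S. S \<in> items \<and> u \<in> S} = insert T {S. S \<in> items \<and> u \<in> S \<and> v \<notin> S}"
      using T u v linear unfolding items_def by auto
    then have "(\<Sum>S | S \<in> items \<and> u \<in> S. p S) = p T + (\<Sum>S | S \<in> items \<and> u \<in> S \<and> v \<notin> S. p S)"
      using v finite_items by simp
    then show ?thesis using sum_p_at[of u] u T_sub[OF T] by auto
  qed
  have J_eq: "J v T = {S. S \<in> items \<and> a \<in> S \<and> v \<notin> S} \<union> {S. S \<in> items \<and> b \<in> S \<and> v \<notin> S}"
    unfolding J_def T_eq by blast
  have "{S. S \<in> items \<and> a \<in> S \<and> v \<notin> S} \<inter> {S. S \<in> items \<and> b \<in> S \<and> v \<notin> S} = {}"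
  proof -
    have "v \<in> S" if S: "S \<in> items" "a \<in> S" "b \<in> S" for S
    proof -
      have "S \<in> \<T>" using S ab(2) unfolding items_def by auto
      then have "S = T" using linear[of S T a b] T S ab by auto
      then show ?thesis using v by simp
    qed
    then show ?thesis by blast
  qed
  then have "sum p (J v T) = (\<Sum>S | S \<in> items \<and> a \<in> S \<and> v \<notin> S. p S) + (\<Sum>S | S \<in> items \<and> b \<in> S \<and> v \<notin> S. p S)"
    unfolding J_eq using finite_items by (intro sum.union_disjoint) auto
  moreover have "a \<in> T" "a \<noteq> v" "b \<in> T" "b \<noteq> v" using ab(1) by auto
  ultimately have "sum p (J v T) = (\<theta> - p T) + (\<theta> - p T)" by (simp add: star)
  moreover have "p T \<le> \<theta> * \<eta>" using p_T[OF T] \<phi>_bounds(2)[OF T] \<theta> by simp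
  ultimately show ?thesis by (simp add: algebra_simps)
qed

text \<open>The survivals of two triples at \<open>v\<close> are nearly independent: an item that threatens both contains one of four
  pairs of distinct points, and each pair lies in at most one triple.\<close>

lemma sum_p_J_Int:
  assumes T: "T \<in> \<T>" "v \<in> T" and T': "T' \<in> \<T>" "v \<in> T'" and ne: "T \<noteq> T'"
  shows "sum p (J v T \<inter> J v T') \<le> 4 * \<theta> * \<eta>"
proof -
  define pr where "pr = (T - {v}) \<times> (T' - {v})"
  have fin: "finite pr" and card: "card pr = 4"
    unfolding pr_def using T T' card_T finite_T by (auto simp: card_cartesian_product)
  have xy: "fst z \<noteq> snd z" if "z \<in> pr" for z
  proof
    assume "fst z = snd z"
    then have "fst z \<in> T" "fst z \<in> T'" "fst z \<noteq> v" using that unfolding pr_def by auto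
    then show False using linear[OF T(1) T'(1) _ _ T(2) T'(2)] ne by blast
  qed
  have sub: "J v T \<inter> J v T' \<subseteq> (\<Union>z\<in>pr. {S \<in> \<T>. fst z \<in> S \<and> snd z \<in> S})"
  proof
    fix S assume S: "S \<in> J v T \<inter> J v T'"
    then obtain x y where xy': "x \<in> S" "x \<in> T" "y \<in> S" "y \<in> T'" "v \<notin> S" "S \<in> items"
      unfolding J_def by blast
    then have z: "(x, y) \<in> pr" unfolding pr_def by auto
    then have "S \<in> \<T>" using xy[OF z] xy' unfolding items_def by auto
    then show "S \<in> (\<Union>z\<in>pr. {S \<in> \<T>. fst z \<in> S \<and> snd z \<in> S})" using z xy' by force
  qed
  have nonneg: "0 \<le> p S" if "S \<in> \<T>" for S using that p_bounds by (simp add: items_def)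
  have "sum p (J v T \<inter> J v T') \<le> sum p (\<Union>z\<in>pr. {S \<in> \<T>. fst z \<in> S \<and> snd z \<in> S})"
    using sub fin finite_\<T> nonneg by (intro sum_mono2) auto
  also have "\<dots> \<le> (\<Sum>z\<in>pr. sum p {S \<in> \<T>. fst z \<in> S \<and> snd z \<in> S})"
    using fin finite_\<T> nonneg by (intro sum_UN_le) auto
  also have "\<dots> \<le> (\<Sum>z\<in>pr. \<theta> * \<eta>)"
  proof (rule sum_mono)
    fix z assume z: "z \<in> pr"
    show "sum p {S \<in> \<T>. fst z \<in> S \<and> snd z \<in> S} \<le> \<theta> * \<eta>"
    proof (cases "\<exists>S\<in>\<T>. fst z \<in> S \<and> snd z \<in> S")
      case True
      then obtain S where S: "S \<in> \<T>" "fst z \<in> S" "snd z \<in> S" by blast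
      then have "{S \<in> \<T>. fst z \<in> S \<and> snd z \<in> S} = {S}" using linear xy[OF z] by blast
      then show ?thesis using p_T[OF S(1)] \<phi>_bounds(2)[OF S(1)] \<theta> by simp
    next
      case False
      then have "{S \<in> \<T>. fst z \<in> S \<and> snd z \<in> S} = {}" by blast
      then show ?thesis using \<theta> \<eta>0 by (simp only: sum.empty) simp
    qed
  qed
  finally show ?thesis using card by simp
qed

text \<open>A second moment estimate: the mean of \<open>(1 + 2 \<theta>) Y v\<close> exceeds \<open>1\<close> by at most \<open>\<eta>\<close>, and the variance of \<open>Y v\<close> is at most
  \<open>2 \<eta>\<close>.\<close>

lemma E_overload:
  assumes v: "v \<in> X"
  shows "E (\<lambda>R. max 0 ((1 + 2 * \<theta>) * Y v R - 1)) \<le> 4 * \<theta>\<^sup>2"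
proof -
  define A where "A = {T. T \<in> \<T> \<and> v \<in> T}"
  define \<iota> where "\<iota> T R = (of_bool (R \<inter> J v T = {}) :: real)" for T R
  define P where "P T = (\<Prod>S\<in>J v T. 1 - p S)" for T
  define Z where "Z R = (\<Sum>T\<in>A. \<phi> T * (\<iota> T R - P T))" for R
  have A: "finite A" "T \<in> A \<Longrightarrow> 0 \<le> \<phi> T" "T \<in> A \<Longrightarrow> \<phi> T \<le> \<eta>" for T
    using finite_\<T> \<phi>_bounds unfolding A_def by auto
  have L: "(\<Sum>T\<in>A. \<phi> T) \<le> 1" "0 \<le> (\<Sum>T\<in>A. \<phi> T)"
    using load_le_1[OF v] load_nonneg[of v] unfolding A_def load_def by auto
  have E\<iota>: "E (\<iota> T) = P T" for T
    unfolding \<iota>_def P_def using finite_items J_sub by (rule expect_avoid)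
  have P01: "0 \<le> 1 - p S" "1 - p S \<le> 1" if "S \<in> J v T" for S T
    using that J_sub[of v T] p_bounds by auto
  have P0: "0 \<le> P T" "P T \<le> 1" for T
    unfolding P_def using P01 by (auto intro!: prod_nonneg prod_le_1)
  \<comment> \<open>Survival has probability at most \<open>exp (- 2 \<theta> (1 - \<eta>))\<close>, and \<open>1 + 2 \<theta> \<le> exp (2 \<theta>)\<close>.\<close>
  have mean: "(1 + 2 * \<theta>) * (\<Sum>T\<in>A. \<phi> T * P T) \<le> 1 + \<eta>"
  proof -
    have Ple: "P T \<le> exp (- (2 * \<theta> * (1 - \<eta>)))" if "T \<in> A" for T
    proof -
      have "P T \<le> exp (- sum p (J v T))" unfolding P_def using J_sub by (rule prod_upper)
      also have "\<dots> \<le> exp (- (2 * \<theta> * (1 - \<eta>)))"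
        using sum_p_J that unfolding A_def by simp
      finally show ?thesis .
    qed
    have "(\<Sum>T\<in>A. \<phi> T * P T) \<le> (\<Sum>T\<in>A. \<phi> T) * exp (- (2 * \<theta> * (1 - \<eta>)))"
      unfolding sum_distrib_right using A Ple by (intro sum_mono mult_left_mono) auto
    also have "\<dots> \<le> exp (- (2 * \<theta> * (1 - \<eta>)))"
      using L by (simp add: mult_left_le_one_le)
    finally have "(1 + 2 * \<theta>) * (\<Sum>T\<in>A. \<phi> T * P T) \<le> exp (2 * \<theta>) * exp (- (2 * \<theta> * (1 - \<eta>)))"
      using A P0 \<theta> exp_ge_add_one_self[of "2 * \<theta>"] by (intro mult_mono) (auto intro!: sum_nonneg mult_nonneg_nonneg)
    also have "\<dots> = exp (2 * \<theta> * \<eta>)" by (simp add: exp_add[symmetric] algebra_simps)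
    also have "\<dots> \<le> 1 + 2 * \<theta> * \<eta> + (2 * \<theta> * \<eta>)\<^sup>2"
      using \<theta> \<eta>0 \<eta>_le_1 by (intro exp_bound) (auto intro: mult_le_one)
    also have "\<dots> \<le> 1 + \<eta>"
    proof -
      have *: "2 * \<theta> * \<eta> \<le> \<eta> / 2" "0 \<le> 2 * \<theta> * \<eta>"
        using mult_right_mono[OF \<theta>(2) \<eta>0] \<theta> \<eta>0 by auto
      then have "(2 * \<theta> * \<eta>)\<^sup>2 \<le> (\<eta> / 2)\<^sup>2" by (intro power_mono)
      also have "\<dots> \<le> \<eta> / 2" using mult_left_mono[OF \<eta>_le_1 \<eta>0] \<eta>0 by (simp add: power2_eq_square)
      finally show ?thesis using * by simp
    qed
    finally show ?thesis .
  qed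
  \<comment> \<open>The joint survival probability differs from the product by the factors of the common threats.\<close>
  have cov: "E (\<lambda>R. (\<iota> T R - P T) * (\<iota> T' R - P T')) \<le> 4 * \<theta> * \<eta> + of_bool (T = T')"
    if T: "T \<in> A" "T' \<in> A" for T T'
  proof -
    have fJ: "finite (J v S)" for S using J_sub finite_items by (rule finite_subset)
    have "E (\<lambda>R. (\<iota> T R - P T) * (\<iota> T' R - P T'))
        = E (\<lambda>R. of_bool (R \<inter> (J v T \<union> J v T') = {}) - P T' * \<iota> T R - P T * \<iota> T' R + P T * P T')"
      by (intro expect_cong) (auto simp: \<iota>_def algebra_simps Int_Un_distrib)
    also have "\<dots> = (\<Prod>S\<in>J v T \<union> J v T'. 1 - p S) - P T * P T'"
      using finite_items J_sub by (simp add: expect_add expect_diff expect_cmult expect_const E\<iota> expect_avoid)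
    finally have eq: "E (\<lambda>R. (\<iota> T R - P T) * (\<iota> T' R - P T')) = (\<Prod>S\<in>J v T \<union> J v T'. 1 - p S) - P T * P T'" .
    have U: "0 \<le> (\<Prod>S\<in>J v T \<union> J v T'. 1 - p S)" "(\<Prod>S\<in>J v T \<union> J v T'. 1 - p S) \<le> 1"
      using P01 by (auto intro!: prod_nonneg prod_le_1)
    show ?thesis
    proof (cases "T = T'")
      case True
      have "0 \<le> P T * P T'" "0 \<le> 4 * \<theta> * \<eta>" using P0 \<theta> \<eta>0 by auto
      then have "E (\<lambda>R. (\<iota> T R - P T) * (\<iota> T' R - P T')) \<le> 4 * \<theta> * \<eta> + 1" using U(2) eq by linarith
      then show ?thesis using True by simp
    next
      case False
      have "P T * P T' = (\<Prod>S\<in>J v T \<union> J v T'. 1 - p S) * (\<Prod>S\<in>J v T \<inter> J v T'. 1 - p S)"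
        unfolding P_def using prod.union_inter[OF fJ fJ] by metis
      then have "(\<Prod>S\<in>J v T \<union> J v T'. 1 - p S) - P T * P T'
          = (\<Prod>S\<in>J v T \<union> J v T'. 1 - p S) * (1 - (\<Prod>S\<in>J v T \<inter> J v T'. 1 - p S))"
        by (simp add: algebra_simps)
      also have "\<dots> \<le> 1 * sum p (J v T \<inter> J v T')"
      proof (intro mult_mono U)
        have "J v T \<inter> J v T' \<subseteq> items" using J_sub by blast
        from prod_lower[OF this] show "1 - (\<Prod>S\<in>J v T \<inter> J v T'. 1 - p S) \<le> sum p (J v T \<inter> J v T')" by simp
        show "0 \<le> 1 - (\<Prod>S\<in>J v T \<inter> J v T'. 1 - p S)" using P01 by (auto intro!: prod_le_1)
      qed simp
      also have "\<dots> \<le> 4 * \<theta> * \<eta>" using sum_p_J_Int T False unfolding A_def by simp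
      finally show ?thesis using eq False by simp
    qed
  qed
  have var: "E (\<lambda>R. (Z R)\<^sup>2) \<le> 2 * \<eta>"
  proof -
    have "(Z R)\<^sup>2 = (\<Sum>T\<in>A. \<Sum>T'\<in>A. \<phi> T * \<phi> T' * ((\<iota> T R - P T) * (\<iota> T' R - P T')))" for R
      unfolding Z_def power2_eq_square sum_product by (intro sum.cong refl) (simp add: mult_ac)
    then have "E (\<lambda>R. (Z R)\<^sup>2) = (\<Sum>T\<in>A. \<Sum>T'\<in>A. \<phi> T * \<phi> T' * E (\<lambda>R. (\<iota> T R - P T) * (\<iota> T' R - P T')))"
      by (simp add: expect_sum expect_cmult)
    also have "\<dots> \<le> (\<Sum>T\<in>A. \<Sum>T'\<in>A. \<phi> T * \<phi> T' * (4 * \<theta> * \<eta> + of_bool (T = T')))"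
      using cov A by (intro sum_mono mult_left_mono) auto
    also have "\<dots> = (\<Sum>T\<in>A. \<Sum>T'\<in>A. \<phi> T * \<phi> T') * (4 * \<theta> * \<eta>) + (\<Sum>T\<in>A. \<phi> T * \<phi> T)"
    proof -
      have "(\<Sum>T'\<in>A. \<phi> T * \<phi> T' * of_bool (T = T')) = \<phi> T * \<phi> T" if "T \<in> A" for T
        using A(1) that by (simp add: of_bool_def if_distrib[of "\<lambda>a. _ * a"] cong: if_cong)
      then show ?thesis by (simp add: distrib_left sum.distrib sum_distrib_right)
    qed
    also have "\<dots> \<le> 1 * (4 * \<theta> * \<eta>) + \<eta>"
    proof (intro add_mono mult_right_mono)
      show "(\<Sum>T\<in>A. \<Sum>T'\<in>A. \<phi> T * \<phi> T') \<le> 1"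
        unfolding sum_product[symmetric] using L by (intro mult_le_one) auto
      have "(\<Sum>T\<in>A. \<phi> T * \<phi> T) \<le> (\<Sum>T\<in>A. \<phi> T * \<eta>)" using A by (intro sum_mono mult_left_mono) auto
      also have "\<dots> \<le> \<eta>" using L \<eta>0 by (simp add: sum_distrib_right[symmetric] mult_left_le_one_le)
      finally show "(\<Sum>T\<in>A. \<phi> T * \<phi> T) \<le> \<eta>" .
    qed (use \<theta> \<eta>0 in auto)
    also have "\<dots> \<le> 2 * \<eta>" using mult_right_mono[OF \<theta>(2) \<eta>0] by simp
    finally show ?thesis .
  qed
  \<comment> \<open>Bounding \<open>\<bar>Z\<bar>\<close> by a quadratic polynomial avoids the Cauchy-Schwarz inequality for the expectation.\<close>
  have "max 0 ((1 + 2 * \<theta>) * Y v R - 1) \<le> (\<eta> + 2 * \<theta>\<^sup>2) + 1 / (2 * \<theta>\<^sup>2) * (Z R)\<^sup>2" for R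
  proof -
    have "Y v R = Z R + (\<Sum>T\<in>A. \<phi> T * P T)"
      unfolding Y_def Z_def A_def \<iota>_def by (simp add: sum.distrib[symmetric] algebra_simps)
    then have "(1 + 2 * \<theta>) * Y v R - 1 \<le> (1 + 2 * \<theta>) * Z R + \<eta>"
      using mean by (simp add: distrib_left)
    also have "(1 + 2 * \<theta>) * Z R \<le> (1 + 2 * \<theta>) * \<bar>Z R\<bar>"
      using \<theta> by (intro mult_left_mono) auto
    also have "\<dots> \<le> 2 * \<bar>Z R\<bar>"
      using \<theta> by (intro mult_right_mono) auto
    also have "2 * \<bar>Z R\<bar> \<le> 2 * \<theta>\<^sup>2 + 1 / (2 * \<theta>\<^sup>2) * (Z R)\<^sup>2"
    proof -
      have "0 \<le> (2 * \<theta>\<^sup>2 - \<bar>Z R\<bar>)\<^sup>2" by simp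
      then have "4 * \<theta>\<^sup>2 * \<bar>Z R\<bar> \<le> 4 * \<theta>\<^sup>2 * \<theta>\<^sup>2 + (Z R)\<^sup>2" by (simp add: power2_eq_square algebra_simps)
      then show ?thesis using \<theta> by (simp add: field_simps)
    qed
    finally show ?thesis using \<eta>0 by simp
  qed
  then have "E (\<lambda>R. max 0 ((1 + 2 * \<theta>) * Y v R - 1)) \<le> E (\<lambda>R. (\<eta> + 2 * \<theta>\<^sup>2) + 1 / (2 * \<theta>\<^sup>2) * (Z R)\<^sup>2)"
    by (intro E_mono)
  also have "\<dots> = (\<eta> + 2 * \<theta>\<^sup>2) + 1 / (2 * \<theta>\<^sup>2) * E (\<lambda>R. (Z R)\<^sup>2)"
    using finite_items by (simp only: expect_add expect_cmult expect_const)
  also have "\<dots> \<le> (\<eta> + 2 * \<theta>\<^sup>2) + 1 / (2 * \<theta>\<^sup>2) * (2 * \<theta> ^ 4)"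
    using var \<eta> by (intro add_left_mono mult_left_mono) auto
  also have "\<dots> = \<eta> + 3 * \<theta>\<^sup>2" using \<theta> by (simp add: field_simps eval_nat_numeral)
  also have "\<dots> \<le> 4 * \<theta>\<^sup>2" using \<eta>_le by simp
  finally show ?thesis .
qed

lemma total_le: "(\<Sum>T\<in>\<T>. \<phi> T) \<le> real (card X)"
proof -
  have "(\<Sum>T\<in>\<T>. \<phi> T) \<le> (\<Sum>T\<in>\<T>. (\<Sum>v\<in>T. 1) * \<phi> T)"
  proof (rule sum_mono)
    fix T assume T: "T \<in> \<T>"
    then show "\<phi> T \<le> (\<Sum>v\<in>T. 1) * \<phi> T" using card_T[OF T] \<phi>_bounds(1)[OF T] by simp
  qed
  also have "\<dots> = (\<Sum>v\<in>X. 1 * load \<T> \<phi> v)" using finite_X T_sub by (rule sum_load[symmetric])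
  also have "\<dots> \<le> (\<Sum>v\<in>X. 1)" using load_le_1 by (intro sum_mono) auto
  finally show ?thesis by simp
qed

text \<open>The potential of an outcome is the number of triples kept plus the remaining fractional weight minus \<open>c\<close> times the
  number of remaining points. In expectation \<open>\<theta>\<close> times the weight is kept, about as much weight is lost, and at least
  a proportion \<open>\<theta> / 2\<close> of the points disappears, so that some outcome improves \<open>c\<close> to \<open>c (1 - \<theta> / 2) + 13 \<theta>\<^sup>2\<close>.\<close>

lemma one_bite:
  fixes c :: real
  assumes c: "0 \<le> c"
  obtains M \<T>' X' \<psi> where "M \<subseteq> \<T>" "disjoint M" "\<T>' \<subseteq> \<T>" "\<forall>S\<in>M. \<forall>T\<in>\<T>'. S \<inter> T = {}"
    "spread_system X' \<T>' \<psi> (2 * \<eta>)"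
    "(\<Sum>T\<in>\<T>. \<phi> T) - (c * (1 - \<theta> / 2) + 13 * \<theta>\<^sup>2) * real (card X)
      \<le> real (card M) + (\<Sum>T\<in>\<T>'. \<psi> T) - c * real (card X')"
proof -
  define iso surv where "iso T R \<longleftrightarrow> T \<in> R \<and> R \<inter> (hit T - {T}) = {}" and "surv T R \<longleftrightarrow> R \<inter> hit T = {}" for T R
  define score where "score R = (\<Sum>T\<in>\<T>. of_bool (iso T R)) + (\<Sum>T\<in>\<T>. (1 + 2 * \<theta>) * \<phi> T * of_bool (surv T R))
    - (\<Sum>v\<in>X. max 0 ((1 + 2 * \<theta>) * Y v R - 1)) - (\<Sum>v\<in>X. c * of_bool (v \<notin> \<Union>R))" for R
  have "(\<Sum>T\<in>\<T>. \<phi> T) - (c * (1 - \<theta> / 2) + 13 * \<theta>\<^sup>2) * real (card X) \<le> E score"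
  proof -
    have "(\<Sum>T\<in>\<T>. \<phi> T) - (c * (1 - \<theta> / 2) + 13 * \<theta>\<^sup>2) * real (card X)
        \<le> (1 - 9 * \<theta>\<^sup>2) * (\<Sum>T\<in>\<T>. \<phi> T) - real (card X) * (4 * \<theta>\<^sup>2) - real (card X) * (c * (1 - \<theta> / 2))"
      using mult_left_mono[OF total_le, of "9 * \<theta>\<^sup>2"] by (simp add: algebra_simps)
    \<comment> \<open>\<open>\<theta> (1 - 3 \<theta>) + (1 + 2 \<theta>) (1 - 3 \<theta>) = 1 - 9 \<theta>\<^sup>2\<close>\<close>
    also have "(1 - 9 * \<theta>\<^sup>2) * (\<Sum>T\<in>\<T>. \<phi> T)
        = (\<Sum>T\<in>\<T>. \<theta> * \<phi> T * (1 - 3 * \<theta>)) + (\<Sum>T\<in>\<T>. (1 + 2 * \<theta>) * \<phi> T * (1 - 3 * \<theta>))"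
      unfolding sum_distrib_left sum.distrib[symmetric]
      by (intro sum.cong refl) (simp add: power2_eq_square algebra_simps)
    also have "(\<Sum>T\<in>\<T>. \<theta> * \<phi> T * (1 - 3 * \<theta>)) \<le> (\<Sum>T\<in>\<T>. E (\<lambda>R. of_bool (iso T R)))"
      unfolding iso_def using E_isolated by (rule sum_mono)
    also have "(\<Sum>T\<in>\<T>. (1 + 2 * \<theta>) * \<phi> T * (1 - 3 * \<theta>)) \<le> (\<Sum>T\<in>\<T>. (1 + 2 * \<theta>) * \<phi> T * E (\<lambda>R. of_bool (surv T R)))"
      unfolding surv_def using E_survive_triple \<theta> \<phi>_bounds by (intro sum_mono mult_left_mono) auto
    also have "real (card X) * (4 * \<theta>\<^sup>2) = (\<Sum>v\<in>X. 4 * \<theta>\<^sup>2)" by simp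
    also have "real (card X) * (c * (1 - \<theta> / 2)) = (\<Sum>v\<in>X. c * (1 - \<theta> / 2))" by simp
    finally have "(\<Sum>T\<in>\<T>. \<phi> T) - (c * (1 - \<theta> / 2) + 13 * \<theta>\<^sup>2) * real (card X)
        \<le> (\<Sum>T\<in>\<T>. E (\<lambda>R. of_bool (iso T R))) + (\<Sum>T\<in>\<T>. (1 + 2 * \<theta>) * \<phi> T * E (\<lambda>R. of_bool (surv T R)))
          - (\<Sum>v\<in>X. 4 * \<theta>\<^sup>2) - (\<Sum>v\<in>X. c * (1 - \<theta> / 2))" by simp
    moreover have "(\<Sum>v\<in>X. E (\<lambda>R. max 0 ((1 + 2 * \<theta>) * Y v R - 1))) \<le> (\<Sum>v\<in>X. 4 * \<theta>\<^sup>2)"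
      using E_overload by (rule sum_mono)
    moreover have "(\<Sum>v\<in>X. c * E (\<lambda>R. of_bool (v \<notin> \<Union>R))) \<le> (\<Sum>v\<in>X. c * (1 - \<theta> / 2))"
      using E_survive_vertex c by (intro sum_mono mult_left_mono)
    moreover have "E score = (\<Sum>T\<in>\<T>. E (\<lambda>R. of_bool (iso T R))) + (\<Sum>T\<in>\<T>. (1 + 2 * \<theta>) * \<phi> T * E (\<lambda>R. of_bool (surv T R)))
          - (\<Sum>v\<in>X. E (\<lambda>R. max 0 ((1 + 2 * \<theta>) * Y v R - 1))) - (\<Sum>v\<in>X. c * E (\<lambda>R. of_bool (v \<notin> \<Union>R)))"
      unfolding score_def by (simp only: expect_add expect_diff expect_sum expect_cmult)
    ultimately show ?thesis by linarith
  qed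
  then obtain R where R: "R \<subseteq> items"
    "(\<Sum>T\<in>\<T>. \<phi> T) - (c * (1 - \<theta> / 2) + 13 * \<theta>\<^sup>2) * real (card X) \<le> score R"
    using expect_attained[of items p, OF finite_items p_bounds] by blast
  define M where "M = {T \<in> \<T>. iso T R}"
  define \<T>' where "\<T>' = {T \<in> \<T>. surv T R}"
  define X' where "X' = X - \<Union>R"
  have sub: "T \<subseteq> X'" if "T \<in> \<T>'" for T
    using that T_sub R(1) unfolding \<T>'_def X'_def surv_def hit_def by fastforce
  have X': "finite X'" "X' \<subseteq> X" unfolding X'_def using finite_X by auto
  obtain \<psi> where \<psi>: "\<And>T. T \<in> \<T>' \<Longrightarrow> 0 \<le> \<psi> T \<and> \<psi> T \<le> (1 + 2 * \<theta>) * \<phi> T" "\<And>v. v \<in> X' \<Longrightarrow> load \<T>' \<psi> v \<le> 1"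
    "(\<Sum>T\<in>\<T>'. (1 + 2 * \<theta>) * \<phi> T) - (\<Sum>v\<in>X'. max 0 (load \<T>' (\<lambda>T. (1 + 2 * \<theta>) * \<phi> T) v - 1)) \<le> (\<Sum>T\<in>\<T>'. \<psi> T)"
    using trim_overload[OF X'(1) sub, of \<T>' "\<lambda>T. (1 + 2 * \<theta>) * \<phi> T"] \<theta> \<phi>_bounds unfolding \<T>'_def by auto
  show thesis
  proof (rule that[of M \<T>' X' \<psi>])
    show "M \<subseteq> \<T>" "\<T>' \<subseteq> \<T>" unfolding M_def \<T>'_def by auto
    show "disjoint M"
      unfolding disjoint_def M_def iso_def hit_def using R(1) by blast
    show "\<forall>S\<in>M. \<forall>T\<in>\<T>'. S \<inter> T = {}"
      using R(1) unfolding M_def \<T>'_def iso_def surv_def hit_def by blast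
    show "spread_system X' \<T>' \<psi> (2 * \<eta>)"
      unfolding spread_system_def
    proof (intro conjI ballI impI)
      show "finite X'" by (rule X')
      show "load \<T>' \<psi> v \<le> 1" if "v \<in> X'" for v using \<psi>(2) that .
      fix T assume T: "T \<in> \<T>'"
      then have T': "T \<in> \<T>" by (simp add: \<T>'_def)
      show "T \<subseteq> X'" "card T = 3" "0 \<le> \<psi> T" using sub card_T T T' \<psi>(1) by auto
      have "\<psi> T \<le> (1 + 2 * \<theta>) * \<phi> T" using \<psi>(1) T by simp
      also have "\<dots> \<le> 2 * \<eta>" using \<theta> \<phi>_bounds[OF T'] by (intro mult_mono) auto
      finally show "\<psi> T \<le> 2 * \<eta>" .
      fix S assume "S \<in> \<T>'" "T \<noteq> S"
      then show "card (T \<inter> S) \<le> 1" using sys T' unfolding spread_system_def \<T>'_def by blast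
    qed
    have over: "(\<Sum>v\<in>X'. max 0 (load \<T>' (\<lambda>T. (1 + 2 * \<theta>) * \<phi> T) v - 1)) \<le> (\<Sum>v\<in>X. max 0 ((1 + 2 * \<theta>) * Y v R - 1))"
    proof -
      have "load \<T>' (\<lambda>T. (1 + 2 * \<theta>) * \<phi> T) v \<le> (1 + 2 * \<theta>) * Y v R" for v
      proof -
        have "(\<Sum>T | T \<in> \<T>' \<and> v \<in> T. \<phi> T) = (\<Sum>T | T \<in> \<T> \<and> v \<in> T. \<phi> T * of_bool (surv T R))"
          using finite_\<T> by (intro sum.mono_neutral_cong_left) (auto simp: \<T>'_def)
        also have "\<dots> \<le> Y v R"
          unfolding Y_def surv_def using \<phi>_bounds by (intro sum_mono mult_left_mono) (auto simp: J_def hit_def)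
        finally show ?thesis unfolding load_def using \<theta> by (simp add: sum_distrib_left[symmetric])
      qed
      then have "(\<Sum>v\<in>X'. max 0 (load \<T>' (\<lambda>T. (1 + 2 * \<theta>) * \<phi> T) v - 1)) \<le> (\<Sum>v\<in>X'. max 0 ((1 + 2 * \<theta>) * Y v R - 1))"
        by (intro sum_mono max.mono) auto
      also have "\<dots> \<le> (\<Sum>v\<in>X. max 0 ((1 + 2 * \<theta>) * Y v R - 1))"
        using finite_X X' by (intro sum_mono2) auto
      finally show ?thesis .
    qed
    have "(\<Sum>T\<in>\<T>. of_bool (iso T R)) = real (card M)"
      unfolding M_def using finite_\<T> by (simp add: of_bool_def sum.inter_filter[symmetric])
    moreover have "(\<Sum>T\<in>\<T>. (1 + 2 * \<theta>) * \<phi> T * of_bool (surv T R)) = (\<Sum>T\<in>\<T>'. (1 + 2 * \<theta>) * \<phi> T)"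
      using finite_\<T> by (intro sum.mono_neutral_cong_right) (auto simp: \<T>'_def)
    moreover have "(\<Sum>v\<in>X. c * of_bool (v \<notin> \<Union>R)) = c * real (card X')"
    proof -
      have "(\<Sum>v\<in>X. c * of_bool (v \<notin> \<Union>R)) = (\<Sum>v\<in>X'. c)"
        using finite_X by (intro sum.mono_neutral_cong_right) (auto simp: X'_def)
      then show ?thesis by (simp add: mult.commute)
    qed
    ultimately have "score R \<le> real (card M) + (\<Sum>T\<in>\<T>'. \<psi> T) - c * real (card X')"
      using \<psi>(3) over unfolding score_def by linarith
    then show "(\<Sum>T\<in>\<T>. \<phi> T) - (c * (1 - \<theta> / 2) + 13 * \<theta>\<^sup>2) * real (card X)
      \<le> real (card M) + (\<Sum>T\<in>\<T>'. \<psi> T) - c * real (card X')" using R(2) by linarith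
  qed
qed

end

lemma spread_system_mono:
  assumes "spread_system X \<T> \<phi> \<eta>" "\<eta> \<le> \<eta>'"
  shows "spread_system X \<T> \<phi> \<eta>'"
proof -
  have "\<forall>T\<in>\<T>. 0 \<le> \<phi> T \<and> \<phi> T \<le> \<eta>'"
    using assms unfolding spread_system_def by auto
  then show ?thesis
    using assms(1) unfolding spread_system_def by (elim conjE) (intro conjI; assumption)
qed

text \<open>The special case of the theorems of Frankl and Roedl and of Pippenger that is needed here: a spread fractional
  matching can be rounded to a matching with a loss of \<open>\<epsilon>\<close> per point. Instead of iterating the bite and tracking the
  errors, consider the infimum \<open>c0\<close> of all admissible losses. Were it positive, a single bite with \<open>\<theta>\<close> small
  compared with \<open>c0\<close> would improve a loss near \<open>c0\<close> to one below it.\<close>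

theorem matching_of_spread_system:
  fixes \<epsilon> :: real
  assumes \<epsilon>: "0 < \<epsilon>"
  obtains \<eta> where "0 < \<eta>" "\<And>(X :: 'a set) \<T> \<phi>. spread_system X \<T> \<phi> \<eta> \<Longrightarrow>
    \<exists>M\<subseteq>\<T>. disjoint M \<and> (\<Sum>T\<in>\<T>. \<phi> T) - \<epsilon> * real (card X) \<le> real (card M)"
proof -
  define ok where "ok c \<longleftrightarrow> (\<exists>\<eta>>0. \<forall>(X :: 'a set) \<T> \<phi>. spread_system X \<T> \<phi> \<eta> \<longrightarrow>
    (\<exists>M\<subseteq>\<T>. disjoint M \<and> (\<Sum>T\<in>\<T>. \<phi> T) - c * real (card X) \<le> real (card M)))" for c
  have step: "ok (c * (1 - \<theta> / 2) + 13 * \<theta>\<^sup>2)" if c: "ok c" "0 \<le> c" and \<theta>: "0 < \<theta>" "\<theta> \<le> 1/4" for c \<theta>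
  proof -
    obtain \<zeta> where \<zeta>: "0 < \<zeta>" "\<And>(X :: 'a set) \<T> \<phi>. spread_system X \<T> \<phi> \<zeta> \<Longrightarrow>
      \<exists>M\<subseteq>\<T>. disjoint M \<and> (\<Sum>T\<in>\<T>. \<phi> T) - c * real (card X) \<le> real (card M)"
      using c(1) unfolding ok_def by blast
    define \<eta> where "\<eta> = min (\<zeta> / 2) (\<theta> ^ 4)"
    have small: "0 < \<eta>" "2 * \<eta> \<le> \<zeta>" "\<eta> \<le> \<theta> ^ 4" unfolding \<eta>_def using \<zeta>(1) \<theta> by auto
    have "\<exists>M\<subseteq>\<T>. disjoint M \<and> (\<Sum>T\<in>\<T>. \<phi> T) - (c * (1 - \<theta> / 2) + 13 * \<theta>\<^sup>2) * real (card X) \<le> real (card M)"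
      if sys: "spread_system X \<T> \<phi> \<eta>" for X :: "'a set" and \<T> \<phi>
    proof -
      interpret bite X \<T> \<phi> \<eta> \<theta>
        by (rule bite.intro[OF sys \<theta> small(3) less_imp_le[OF small(1)]])
      obtain M \<T>' X' \<psi> where b: "M \<subseteq> \<T>" "disjoint M" "\<T>' \<subseteq> \<T>" "\<forall>S\<in>M. \<forall>T\<in>\<T>'. S \<inter> T = {}"
        "spread_system X' \<T>' \<psi> (2 * \<eta>)"
        "(\<Sum>T\<in>\<T>. \<phi> T) - (c * (1 - \<theta> / 2) + 13 * \<theta>\<^sup>2) * real (card X)
          \<le> real (card M) + (\<Sum>T\<in>\<T>'. \<psi> T) - c * real (card X')"
        by (rule one_bite[OF c(2)])
      obtain M' where M': "M' \<subseteq> \<T>'" "disjoint M'" "(\<Sum>T\<in>\<T>'. \<psi> T) - c * real (card X') \<le> real (card M')"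
        using \<zeta>(2)[OF spread_system_mono[OF b(5) small(2)]] by blast
      have apart: "S \<inter> T = {}" if "S \<in> M" "T \<in> M'" for S T
        using b(4) M'(1) that by (meson subsetD)
      then have "\<Union>M \<inter> \<Union>M' = {}" by blast
      then have disj: "disjoint (M \<union> M')" by (rule disjoint_union[OF b(2) M'(2)])
      have "M \<inter> M' = {}"
      proof -
        have False if "T \<in> M" "T \<in> M'" for T
        proof -
          have "T = {}" using apart[OF that] by simp
          then show False using card_T[of T] that b(1) by auto
        qed
        then show ?thesis by blast
      qed
      moreover have sub: "M \<union> M' \<subseteq> \<T>" using b(1,3) M'(1) by blast
      then have "finite (M \<union> M')" using finite_\<T> by (rule finite_subset)
      ultimately have "card (M \<union> M') = card M + card M'" by (simp add: card_Un_disjoint)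
      then have "(\<Sum>T\<in>\<T>. \<phi> T) - (c * (1 - \<theta> / 2) + 13 * \<theta>\<^sup>2) * real (card X) \<le> real (card (M \<union> M'))"
        using b(6) M'(3) by linarith
      then show ?thesis using sub disj by blast
    qed
    then show ?thesis unfolding ok_def using small(1) by (intro exI[of _ \<eta>] conjI allI impI)
  qed
  have "ok 1"
  proof -
    have "(\<Sum>T\<in>\<T>. \<phi> T) \<le> real (card X)" if "spread_system X \<T> \<phi> ((1/4) ^ 4)" for X :: "'a set" and \<T> \<phi>
    proof -
      interpret bite X \<T> \<phi> "(1/4) ^ 4" "1/4" by (rule bite.intro[OF that]) simp_all
      show ?thesis by (rule total_le)
    qed
    then show ?thesis
      unfolding ok_def by (intro exI[of _ "(1/4) ^ 4"]) (auto intro!: exI[of _ "{}"] simp: disjoint_def)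
  qed
  define C where "C = {c. 0 \<le> c \<and> ok c}"
  define c0 where "c0 = Inf C"
  have C: "1 \<in> C" "bdd_below C" unfolding C_def bdd_below_def using \<open>ok 1\<close> by auto
  have "\<not> 0 < c0"
  proof
    assume c0: "0 < c0"
    define \<theta> where "\<theta> = min (1/4) (c0 / 104)"
    have \<theta>: "0 < \<theta>" "\<theta> \<le> 1/4" "13 * \<theta> \<le> c0 / 8" unfolding \<theta>_def using c0 by auto
    have "Inf C < c0 * (1 + \<theta> / 8)" unfolding c0_def[symmetric] using c0 \<theta> by simp
    then obtain c where c: "c \<in> C" "c < c0 * (1 + \<theta> / 8)"
      using C cInf_less_iff[of C] by blast
    have "0 \<le> c * (1 - \<theta> / 2) + 13 * \<theta>\<^sup>2" using c(1) \<theta> unfolding C_def by simp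
    then have "c * (1 - \<theta> / 2) + 13 * \<theta>\<^sup>2 \<in> C" using step[of c \<theta>] c(1) \<theta> unfolding C_def by simp
    then have "c0 \<le> c * (1 - \<theta> / 2) + 13 * \<theta>\<^sup>2" unfolding c0_def using C(2) by (rule cInf_lower)
    also have "c * (1 - \<theta> / 2) \<le> c0 * (1 + \<theta> / 8) * (1 - \<theta> / 2)"
      using c(2) \<theta> by (intro mult_right_mono) auto
    also have "\<dots> \<le> c0 * (1 - \<theta> * (3/8))"
      using c0 \<theta> by (simp add: algebra_simps)
    also have "13 * \<theta>\<^sup>2 \<le> c0 * (\<theta> / 8)"
      using mult_right_mono[OF \<theta>(3), of \<theta>] \<theta> by (simp add: power2_eq_square)
    finally have "0 \<le> c0 * (- \<theta> / 4)" by (simp add: algebra_simps)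
    moreover have "0 < c0 * \<theta>" using c0 \<theta> by simp
    ultimately show False by simp
  qed
  then have "Inf C < \<epsilon>" using \<epsilon> unfolding c0_def by linarith
  then obtain c where c: "c \<in> C" "c < \<epsilon>" using C cInf_less_iff[of C] by blast
  then obtain \<eta> where \<eta>: "0 < \<eta>" "\<And>(X :: 'a set) \<T> \<phi>. spread_system X \<T> \<phi> \<eta> \<Longrightarrow>
      \<exists>M\<subseteq>\<T>. disjoint M \<and> (\<Sum>T\<in>\<T>. \<phi> T) - c * real (card X) \<le> real (card M)"
    unfolding C_def ok_def by blast
  show thesis
  proof (rule that[OF \<eta>(1)])
    fix X :: "'a set" and \<T> \<phi> assume "spread_system X \<T> \<phi> \<eta>"
    then obtain M where "M \<subseteq> \<T>" "disjoint M" "(\<Sum>T\<in>\<T>. \<phi> T) - c * real (card X) \<le> real (card M)"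
      using \<eta>(2) by blast
    moreover have "c * real (card X) \<le> \<epsilon> * real (card X)" using c(2) by (intro mult_right_mono) auto
    ultimately show "\<exists>M\<subseteq>\<T>. disjoint M \<and> (\<Sum>T\<in>\<T>. \<phi> T) - \<epsilon> * real (card X) \<le> real (card M)"
      by (intro exI[of _ M]) auto
  qed
qed

section \<open>The asymptotics of the guaranteed packing size\<close>

lemma triangle_eq_nsets:
  assumes "T \<in> triangles E" "e \<in> T" "f \<in> T" "e \<noteq> f"
  shows "T = nsets (e \<union> f) 2"
proof -
  obtain x y z where T: "T = {{x, y}, {y, z}, {x, z}}" and ne: "x \<noteq> y" "y \<noteq> z" "x \<noteq> z"
    using assms(1) unfolding triangles_def by blast
  have "e \<union> f = {x, y, z}" using assms(2-4) unfolding T by auto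
  moreover have "nsets {x, y, z} 2 = T"
    unfolding T nsets_2_eq using ne by (auto simp: insert_commute)
  ultimately show ?thesis by simp
qed

lemma card_triangle_Int:
  assumes "S \<in> triangles E" "T \<in> triangles E" "S \<noteq> T"
  shows "card (S \<inter> T) \<le> 1"
proof (rule ccontr)
  assume "\<not> card (S \<inter> T) \<le> 1"
  moreover have "finite (S \<inter> T)" using card_triangle[OF assms(1)] card_ge_0_finite[of S] by simp
  ultimately obtain e f where "e \<in> S \<inter> T" "f \<in> S \<inter> T" "e \<noteq> f"
    by (auto simp: card_le_Suc0_iff_eq)
  then have "S = nsets (e \<union> f) 2" "T = nsets (e \<union> f) 2"
    using triangle_eq_nsets assms by (metis IntD1, metis IntD2)
  then show False using assms(3) by simp
qed

lemma card_edges_le: "simple_graph V E \<Longrightarrow> card E \<le> card V choose 2"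
  unfolding simple_graph_def using card_mono[of "nsets V 2" E] by (simp add: card_nsets finite_imp_finite_nsets)

lemma real_choose_two: "real (n choose 2) = real n * (real n - 1) / 2"
proof (cases n)
  case (Suc m)
  have "2 * (n choose 2) = n * m" using times_binomial_minus1_eq[of 2 n] Suc by simp
  then have "2 * real (n choose 2) = real n * real m" by (metis of_nat_mult of_nat_numeral)
  then show ?thesis using Suc by simp
qed simp

text \<open>The rounding and the averaging (hence \<open>k \<ge> 9 / \<epsilon>\<close>) may each cost \<open>\<epsilon> n\<^sup>2 / 9\<close> triangles, that is, a third of the
  error budget of \<open>\<epsilon> n\<^sup>2\<close> edges; the rest covers the difference between \<open>n (n - 1)\<close> and \<open>n\<^sup>2\<close>.\<close>

lemma eventually_nu_ge:
  fixes \<epsilon> :: real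
  assumes \<epsilon>: "0 < \<epsilon>"
  shows "eventually (\<lambda>n. \<forall>(V :: 'a set) E. simple_graph V E \<and> card V = n \<and> co_triangle_free V E \<longrightarrow>
    real n ^ 2 / 4 - \<epsilon> * real n ^ 2 \<le> real (nu E)) sequentially"
proof -
  obtain \<eta> where \<eta>: "0 < \<eta>" "\<And>(X :: 'a set set) \<T> \<phi>. spread_system X \<T> \<phi> \<eta> \<Longrightarrow>
    \<exists>M\<subseteq>\<T>. disjoint M \<and> (\<Sum>T\<in>\<T>. \<phi> T) - \<epsilon> / 9 * real (card X) \<le> real (card M)"
    using matching_of_spread_system[of "\<epsilon> / 9"] \<epsilon> by auto
  obtain k0 :: nat where k0: "9 / \<epsilon> \<le> real k0" using real_arch_simple by blast
  define k where "k = max 3 k0"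
  have k: "3 \<le> k" "9 / \<epsilon> \<le> real k" unfolding k_def using k0 by auto
  have "eventually (\<lambda>n. k \<le> n) sequentially" by (rule eventually_ge_at_top)
  moreover have "eventually (\<lambda>n. 2 + real k / \<eta> \<le> real n) sequentially"
    by (rule eventually_compose_filterlim[OF eventually_ge_at_top filterlim_real_sequentially])
  moreover have "eventually (\<lambda>n. 1 / \<epsilon> \<le> real n) sequentially"
    by (rule eventually_compose_filterlim[OF eventually_ge_at_top filterlim_real_sequentially])
  ultimately show ?thesis
  proof eventually_elim
    case (elim n)
    show ?case
    proof (intro allI impI, elim conjE)
      fix V :: "'a set" and E
      assume G: "simple_graph V E" and n: "card V = n" and co: "co_triangle_free V E"
      obtain \<phi> where \<phi>: "\<And>T. 0 \<le> \<phi> T" "\<And>T. T \<in> triangles E \<Longrightarrow> \<phi> T \<le> real (k - 2) / real (n - 2)"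
        "\<And>e. e \<in> E \<Longrightarrow> load (triangles E) \<phi> e \<le> 1"
        "real n * (real n - 1) * (1 / 12 - 1 / real k) \<le> (\<Sum>T\<in>triangles E. \<phi> T)"
        using spread_fractional_packing[OF G co k(1), unfolded n, OF elim(1)] by metis
      have "real (k - 2) / real (n - 2) \<le> \<eta>"
      proof -
        have "0 < real n - 2" "real k \<le> \<eta> * (real n - 2)"
          using elim(1,2) k(1) \<eta>(1) by (auto simp: field_simps)
        then show ?thesis using elim(1) k(1) by (simp add: of_nat_diff divide_le_eq)
      qed
      then have "\<phi> T \<le> \<eta>" if "T \<in> triangles E" for T using \<phi>(2)[OF that] by (rule order_trans[rotated])
      then have "spread_system E (triangles E) \<phi> \<eta>"
        unfolding spread_system_def
        by (intro conjI ballI impI finite_edges[OF G] triangle_subset card_triangle card_triangle_Int \<phi>(1,3))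
      then obtain M where M: "M \<subseteq> triangles E" "disjoint M"
        "(\<Sum>T\<in>triangles E. \<phi> T) - \<epsilon> / 9 * real (card E) \<le> real (card M)"
        using \<eta>(2) by blast
      then have P: "triangle_packing E M" by (simp add: triangle_packing_def)
      have "3 * card M \<le> nu E"
        unfolding nu_def packing_size_eq[OF P, symmetric]
        using finite_sizes[OF finite_edges[OF G]] P by (intro Max_ge) auto
      then have nu: "3 * real (card M) \<le> real (nu E)" by linarith
      have "real (card E) \<le> real (n choose 2)" using card_edges_le[OF G] n by simp
      also have "\<dots> \<le> real n ^ 2" unfolding real_choose_two by (simp add: power2_eq_square algebra_simps)
      finally have cE: "\<epsilon> / 9 * real (card E) \<le> \<epsilon> / 9 * real n ^ 2" using \<epsilon> by (intro mult_left_mono) auto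
      have "1 / real k \<le> \<epsilon> / 9" using k \<epsilon> by (simp add: field_simps)
      then have loss: "(real n * (real n - 1)) * (1 / real k) \<le> real n ^ 2 * (\<epsilon> / 9)"
        using \<epsilon> k elim(1) by (intro mult_mono) (auto simp: power2_eq_square algebra_simps)
      have "real n * (real n - 1) * (1 / 12 - 1 / real k) = real n * (real n - 1) / 12 - (real n * (real n - 1)) * (1 / real k)"
        unfolding right_diff_distrib[of "real n * (real n - 1)"] by simp
      then have "real n * (real n - 1) / 12 - \<epsilon> / 9 * real n ^ 2 \<le> (\<Sum>T\<in>triangles E. \<phi> T)"
        using loss \<phi>(4) by (simp only: mult.commute[of "\<epsilon> / 9"])
      moreover have "real n \<le> \<epsilon> * real n ^ 2"
        using mult_right_mono[OF elim(3), of "real n"] \<epsilon> by (simp add: field_simps power2_eq_square)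
      moreover have "real n * (real n - 1) = real n ^ 2 - real n" by (simp add: power2_eq_square algebra_simps)
      ultimately show "real n ^ 2 / 4 - \<epsilon> * real n ^ 2 \<le> real (nu E)"
        using nu M(3) cE by linarith
    qed
  qed
qed

lemma g_attained:
  obtains V :: "nat set" and E where "simple_graph V E" "card V = n" "co_triangle_free V E" "g n = nu E"
proof -
  define S where "S = {nu E | (V :: nat set) E. simple_graph V E \<and> card V = n \<and> co_triangle_free V E}"
  have "S \<subseteq> {..n choose 2}"
  proof
    fix x assume "x \<in> S"
    then obtain V :: "nat set" and E where VE: "simple_graph V E" "card V = n" "x = nu E"
      unfolding S_def by blast
    then show "x \<in> {..n choose 2}"
      using nu_le_card_edges[OF finite_edges[OF VE(1)]] card_edges_le[OF VE(1)] by simp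
  qed
  then have fin: "finite S" by (rule finite_subset) simp
  have "simple_graph {..<n} (nsets {..<n} 2)" "co_triangle_free {..<n} (nsets {..<n} 2)"
    by (simp_all add: simple_graph_def co_triangle_free_def complement_edges_def triangles_def)
  then have "S \<noteq> {}" unfolding S_def using card_lessThan by blast
  then have "Min S \<in> S" using fin by (rule Min_in[rotated])
  then show thesis using that unfolding g_eq_Min S_def[symmetric] by (auto simp: S_def)
qed

text \<open>Two disjoint cliques of nearly equal size have at most \<open>n\<^sup>2 / 4\<close> edges, and among any three vertices two lie in the
  same clique.\<close>

lemma g_le: "real (g n) \<le> real n ^ 2 / 4"
proof -
  define a where "a = n div 2"
  define b where "b = n - a"
  define E where "E = nsets {..<a} 2 \<union> nsets {a..<n} 2"
  have "n = a + b" "b = a \<or> b = a + 1"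
    unfolding a_def b_def by presburger+
  then have ab: "a \<le> n" "real n = real a + real b" "real b = real a \<or> real b = real a + 1"
    by auto
  have G: "simple_graph {..<n} E"
    unfolding simple_graph_def E_def using ab(1) by (auto intro: nsets_mono[THEN subsetD, rotated])
  have "co_triangle_free {..<n} E"
    unfolding co_triangle_free_def triangles_def complement_edges_def E_def by auto
  then obtain P where P: "triangle_packing E P" "packing_size P = g n"
    using g_works[OF G] by auto
  have "g n \<le> card E" using packing_size_le[OF finite_edges[OF G] P(1)] P(2) by simp
  also have "card E \<le> (a choose 2) + (b choose 2)"
    unfolding E_def b_def by (rule order_trans[OF card_Un_le]) (simp add: card_nsets)
  finally have "real (g n) \<le> real (a choose 2) + real (b choose 2)" by linarith
  also have "\<dots> \<le> (real a + real b) ^ 2 / 4"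
    unfolding real_choose_two using ab(3) by (auto simp: power2_eq_square field_simps)
  finally show ?thesis by (simp add: ab(2))
qed

theorem theorem1p3:
  "(\<lambda>n. real n ^ 2 / 4 - real (g n)) \<in> o(\<lambda>n. real n ^ 2)"
proof (rule landau_o.smallI)
  fix c :: real assume c: "0 < c"
  from eventually_nu_ge[OF c, where 'a = nat]
  show "eventually (\<lambda>n. norm (real n ^ 2 / 4 - real (g n)) \<le> c * norm (real n ^ 2)) sequentially"
  proof eventually_elim
    case (elim n)
    obtain V :: "nat set" and E where "simple_graph V E" "card V = n" "co_triangle_free V E" "g n = nu E"
      by (rule g_attained)
    then have "real n ^ 2 / 4 - c * real n ^ 2 \<le> real (g n)" using elim by metis
    then show ?case using g_le[of n] by simp
  qed
qed

end
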